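(* Let $f\colon\mathbb{N}\to\mathbb{N}\setminus\{0\}$ be a super-additive function, and let $q\in\mathbb{Q}$ with $q>0$. Let $\mathcal{W}_{f,q}$ denote the class of gammoids $M$ with $\mathrm{W}_f(M)\le q$. Then the class $\mathcal{W}_{f,q}$ is closed under duality, minors, and direct sums.
   Context: Matroids are pairs $M=(E,\mathcal{I})$ with $E$ a finite set and $\mathcal{I}$ the family of independent subsets of $E$. For $X\subseteq E$, $M|X$ denotes the restriction of $M$ to $X$, and $M.X$ denotes the contraction of $M$ to $X$, i.e. the matroid on ground set $X$ obtained by contracting $E\setminus X$ (so $M.X=(M^\ast|X)^\ast$, where $M^\ast$ is the dual matroid). The minors of $M$ are the matroids $(M.Y)|X$ with $X\subseteq Y\subseteq E$. Direct sums $M\oplus N$ are formed for matroids with disjoint ground sets. $\mathbb{N}$ contains $0$. A digraph is a pair $D=(V,A)$ with $V$ a finite set and $A\subseteq V\times V$ (loops allowed, no parallel arcs). A vertex is a source if no arc enters it, and a sink if no arc leaves it. A path in $D$ is a non-empty, non-repeating sequence $p=(p_1p_2\ldots p_n)$ of vertices with $(p_i,p_{i+1})\in A$ for $1\le i<n$ (single-vertex paths are allowed); $p_{-1}$ denotes its last vertex $p_n$, and $|p|=\{p_1,\ldots,p_n\}$. For $X,Y\subseteq V$, a routing from $X$ to $Y$ in $D$ is a set $R$ of paths in $D$ such that (i) for each $x\in X$ there is $p\in R$ with $p_1=x$; (ii) $p_{-1}\in Y$ for all $p\in R$; (iii) for all $p,q\in R$, either $p=q$ or $|p|\cap|q|=\emptyset$.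 For a digraph $D=(V,A)$ and $E,T\subseteq V$, the gammoid represented by $(D,T,E)$ is the matroid $\Gamma(D,T,E)=(E,\mathcal{I})$, where $\mathcal{I}$ consists of all $X\subseteq E$ for which there is a routing from $X$ to $T$ in $D$. A matroid $M=(E,\mathcal{I})$ is a gammoid if $M=\Gamma(D,T,E)$ for some digraph $D=(V,A)$ with $E\subseteq V$ and some $T\subseteq V$; then $(D,T,E)$ is called a representation of $M$. It is known (Mason) that duals, minors, and direct sums of gammoids are gammoids. A representation $(D,T,E)$ of $M$ is a standard representation of $M$ if (i) $T\subseteq E$, (ii) every $t\in T$ is a sink in $D$, and (iii) every $e\in E\setminus T$ is a source in $D$. Every gammoid has a standard representation. The arc-complexity of a gammoid $M=(E,\mathcal{I})$ is \[ \mathrm{C}_A(M)=\min\{|A| \mid ((V,A),T,E)\text{ is a standard representation of }M\}. \] A function $f\colon\mathbb{N}\to\mathbb{N}\setminus\{0\}$ is super-additive if $f(n+m)\ge f(n)+f(m)$ for all $n,m\in\mathbb{N}\setminus\{0\}$. For such $f$ and a gammoid $M=(E,\mathcal{I})$, the $f$-width of $M$ is \[ \mathrm{W}_f(M)=\max\left\{\frac{\mathrm{C}_A\left((M.Y)|X\right)}{f(|X|)} \;\middle|\; X\subseteq Y\subseteq E\right\}. \] *)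

theory Defs
  imports
    "HOL-Library.Infinite_Typeclass"
    "Graph_Theory.Pair_Digraph"
    "Graph_Theory.Vertex_Walk"
begin

record 'a indep_system =
  ground :: "'a set"
  indeps :: "'a set set"

locale matroid =
  fixes M :: "'a indep_system"
  assumes finite_ground: "finite (ground M)"
    and indeps_ground: "I \<in> indeps M \<Longrightarrow> I \<subseteq> ground M"
    and empty_indep: "{} \<in> indeps M"
    and indep_subset: "I \<in> indeps M \<Longrightarrow> J \<subseteq> I \<Longrightarrow> J \<in> indeps M"
    and augment: "I \<in> indeps M \<Longrightarrow> J \<in> indeps M \<Longrightarrow> card I < card J \<Longrightarrow>
      \<exists>x \<in> J - I. insert x I \<in> indeps M"

definition bases :: "'a indep_system \<Rightarrow> 'a set set" where
  "bases M = {B \<in> indeps M. \<forall>I \<in> indeps M. B \<subseteq> I \<longrightarrow> I = B}"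

definition dual_matroid :: "'a indep_system \<Rightarrow> 'a indep_system" where
  "dual_matroid M =
    \<lparr>ground = ground M, indeps = {X. X \<subseteq> ground M \<and> (\<exists>B \<in> bases M. X \<inter> B = {})}\<rparr>"

definition restriction :: "'a indep_system \<Rightarrow> 'a set \<Rightarrow> 'a indep_system" where
  "restriction M X = \<lparr>ground = X, indeps = {I \<in> indeps M. I \<subseteq> X}\<rparr>"

text \<open>Contraction \<^emph>\<open>to\<close> \<open>X\<close>, usually written \<open>M.X\<close>: the elements outside \<open>X\<close> are
  contracted away, and the ground set of the result is \<open>X\<close>.\<close>

definition contraction :: "'a indep_system \<Rightarrow> 'a set \<Rightarrow> 'a indep_system" where
  "contraction M X = dual_matroid (restriction (dual_matroid M) X)"

definition minors :: "'a indep_system \<Rightarrow> 'a indep_system set" where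
  "minors M = {restriction (contraction M Y) X | X Y. X \<subseteq> Y \<and> Y \<subseteq> ground M}"

text \<open>Only meaningful for disjoint ground sets.\<close>

definition direct_sum :: "'a indep_system \<Rightarrow> 'a indep_system \<Rightarrow> 'a indep_system" where
  "direct_sum M N =
    \<lparr>ground = ground M \<union> ground N, indeps = {I \<union> J | I J. I \<in> indeps M \<and> J \<in> indeps N}\<rparr>"

text \<open>Digraphs (finite, loops allowed, no parallel arcs) are given by the locale
  \<^locale>\<open>pair_fin_digraph\<close>, and paths by \<^const>\<open>vpath\<close>: non-empty lists of distinct vertices with
  consecutive entries joined by an arc.\<close>

definition source :: "'a pair_pre_digraph \<Rightarrow> 'a \<Rightarrow> bool" where
  "source D v \<longleftrightarrow> v \<in> pverts D \<and> (\<forall>u. (u, v) \<notin> parcs D)"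

definition sink :: "'a pair_pre_digraph \<Rightarrow> 'a \<Rightarrow> bool" where
  "sink D v \<longleftrightarrow> v \<in> pverts D \<and> (\<forall>w. (v, w) \<notin> parcs D)"

text \<open>Paths in a routing from \<open>X\<close> to \<open>Y\<close> that start outside \<open>X\<close> are allowed.\<close>

definition routing :: "'a pair_pre_digraph \<Rightarrow> 'a set \<Rightarrow> 'a set \<Rightarrow> 'a list set \<Rightarrow> bool" where
  "routing D X Y R \<longleftrightarrow>
    (\<forall>p \<in> R. vpath p (with_proj D)) \<and>
    (\<forall>x \<in> X. \<exists>p \<in> R. hd p = x) \<and>
    (\<forall>p \<in> R. last p \<in> Y) \<and>
    (\<forall>p \<in> R. \<forall>q \<in> R. p = q \<or> set p \<inter> set q = {})"

definition gammoid_of :: "'a pair_pre_digraph \<Rightarrow> 'a set \<Rightarrow> 'a set \<Rightarrow> 'a indep_system" where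
  "gammoid_of D T E = \<lparr>ground = E, indeps = {X. X \<subseteq> E \<and> (\<exists>R. routing D X T R)}\<rparr>"

text \<open>The type of vertices plays the role of the universe from which both ground sets and digraph
  vertices are drawn. It has to be infinite: a representation may need auxiliary vertices outside
  the ground set, and over a finite type their supply would be limited.\<close>

definition representation ::
    "'a::infinite pair_pre_digraph \<Rightarrow> 'a set \<Rightarrow> 'a set \<Rightarrow> 'a indep_system \<Rightarrow> bool" where
  "representation D T E M \<longleftrightarrow>
    pair_fin_digraph D \<and> T \<subseteq> pverts D \<and> E \<subseteq> pverts D \<and> M = gammoid_of D T E"

definition gammoid :: "'a::infinite indep_system \<Rightarrow> bool" where
  "gammoid M \<longleftrightarrow> matroid M \<and> (\<exists>D T. representation D T (ground M) M)"

definition standard_representation ::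
    "'a::infinite pair_pre_digraph \<Rightarrow> 'a set \<Rightarrow> 'a set \<Rightarrow> 'a indep_system \<Rightarrow> bool" where
  "standard_representation D T E M \<longleftrightarrow>
    representation D T E M \<and> T \<subseteq> E \<and> (\<forall>t \<in> T. sink D t) \<and> (\<forall>e \<in> E - T. source D e)"

definition arc_complexity :: "'a::infinite indep_system \<Rightarrow> nat" where
  "arc_complexity M =
    (LEAST n. \<exists>D T. standard_representation D T (ground M) M \<and> card (parcs D) = n)"

definition super_additive :: "(nat \<Rightarrow> nat) \<Rightarrow> bool" where
  "super_additive f \<longleftrightarrow>
    (\<forall>n. f n \<noteq> 0) \<and> (\<forall>n m. n \<noteq> 0 \<longrightarrow> m \<noteq> 0 \<longrightarrow> f (n + m) \<ge> f n + f m)"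

definition f_width :: "(nat \<Rightarrow> nat) \<Rightarrow> 'a::infinite indep_system \<Rightarrow> rat" where
  "f_width f M =
    Max {of_nat (arc_complexity (restriction (contraction M Y) X)) / of_nat (f (card X)) | X Y.
      X \<subseteq> Y \<and> Y \<subseteq> ground M}"

definition width_class :: "(nat \<Rightarrow> nat) \<Rightarrow> rat \<Rightarrow> 'a::infinite indep_system set" where
  "width_class f q = {M. gammoid M \<and> f_width f M \<le> q}"

end

theory Submission
  imports Defs
begin

text \<open>A set \<open>X\<close> can be routed to \<open>T\<close> iff there is an injection of the non-targets \<open>V - T\<close> into \<open>V - X\<close>
  moving every vertex at most along one arc (the Ingleton--Piff description). Inverting such an
  injection when \<open>X\<close> is a basis of a standardly represented gammoid shows that reversing all arcs
  and taking \<open>E - T\<close> as targets represents the dual; so duality preserves the arc-complexity, and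
  minors of the dual are duals of minors. Disjoint unions of standard representations show that the
  arc-complexity is subadditive on direct sums. As minors of a direct sum are direct sums of minors,
  super-additivity of \<open>f\<close> gives the bound on the width; a minor with an empty summand is treated
  separately, as super-additivity says nothing about \<open>f 0\<close>.\<close>

text \<open>The value \<open>arc_complexity M\<close> is a \<open>LEAST\<close> and carries
  information only once some standard representation exists, so the known fact that every gammoid
  has one is proved as well. Deletion makes this unavoidable: it keeps digraph and targets, but
  targets may fall outside the new ground set, while the reversal argument for duals needs sinks and
  sources. Hence arbitrary representations are made standard before dualising, and minors follow
  because contraction is deletion in the dual.

  Injections are preferred to path systems because inverting, composing, restricting and gluing are
  operations on functions; they match reversing arcs, changing targets, discarding vertices and
  uniting disjoint digraphs. Sources matter in the reversal: the inverted injection could otherwise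
  enter a vertex of \<open>E\<close> that has to stay free.

  For arc counts, upper bounds suffice: a digraph built for a dual or a direct sum bounds the
  minimum from above, and dualising twice yields the converse bound.\<close>

section \<open>Routings as injections\<close>

text \<open>The witness \<open>\<phi>\<close> sends each vertex on a path of a routing to its successor and fixes all other
  vertices; no path can lead into its starting point, so \<open>X\<close> is avoided.\<close>

definition linked :: "'a set \<Rightarrow> 'a rel \<Rightarrow> 'a set \<Rightarrow> 'a set \<Rightarrow> bool" where
  "linked V A T X \<longleftrightarrow>
    (\<exists>\<phi>. inj_on \<phi> (V - T) \<and> \<phi> ` (V - T) \<subseteq> V - X \<and> (\<forall>v \<in> V - T. \<phi> v = v \<or> (v, \<phi> v) \<in> A))"

lemma linkedI:
  assumes "inj_on \<phi> (V - T)" "\<And>v. v \<in> V - T \<Longrightarrow> \<phi> v \<in> V - X"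
    "\<And>v. v \<in> V - T \<Longrightarrow> \<phi> v = v \<or> (v, \<phi> v) \<in> A"
  shows "linked V A T X"
  using assms unfolding linked_def by blast

lemma linkedE:
  assumes "linked V A T X"
  obtains \<phi> where "inj_on \<phi> (V - T)" "\<And>v. v \<in> V - T \<Longrightarrow> \<phi> v \<in> V - X"
    "\<And>v. v \<in> V - T \<Longrightarrow> \<phi> v = v \<or> (v, \<phi> v) \<in> A"
  using assms unfolding linked_def by blast

lemma linked_subset: "linked V A T X \<Longrightarrow> Y \<subseteq> X \<Longrightarrow> linked V A T Y"
  unfolding linked_def by blast

lemma linked_target: "linked V A T T"
  by (rule linkedI[of id]) auto

lemma linked_card_le:
  assumes "linked V A T X" "finite V" "T \<subseteq> V" "X \<subseteq> V"
  shows "card X \<le> card T"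
proof -
  obtain \<phi> where \<phi>: "inj_on \<phi> (V - T)" "\<phi> ` (V - T) \<subseteq> V - X"
    using assms(1) unfolding linked_def by blast
  have "card (V - T) \<le> card (V - X)"
    using card_inj_on_le[OF \<phi>] assms(2) by simp
  moreover have "card (V - T) = card V - card T" "card (V - X) = card V - card X"
    using assms by (auto simp: card_Diff_subset finite_subset)
  moreover have "card X \<le> card V" "card T \<le> card V"
    using assms by (auto intro: card_mono)
  ultimately show ?thesis by linarith
qed

text \<open>Every vertex but the last moves to its successor. In the induction the new first vertex
  is sent to the old first one, which is free precisely because the image is claimed to avoid
  \<open>hd p\<close>.\<close>

lemma successor_along_path:
  assumes "distinct p" "p \<noteq> []" "set (vwalk_arcs p) \<subseteq> A"
  shows "\<exists>s. inj_on s (set p - {last p}) \<and> s ` (set p - {last p}) \<subseteq> set p - {hd p} \<and>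
    (\<forall>v \<in> set p - {last p}. (v, s v) \<in> A)"
  using assms
proof (induction p)
  case Nil
  then show ?case by simp
next
  case (Cons a p)
  show ?case
  proof (cases "p = []")
    case True
    then show ?thesis by auto
  next
    case False
    with Cons obtain s where s: "inj_on s (set p - {last p})"
      "s ` (set p - {last p}) \<subseteq> set p - {hd p}" "\<forall>v \<in> set p - {last p}. (v, s v) \<in> A"
      by auto
    have a: "a \<notin> set p" "(a, hd p) \<in> A" "hd p \<in> set p" "last p \<in> set p"
      using Cons.prems False by auto
    have eq: "set (a # p) - {last (a # p)} = insert a (set p - {last p})"
      using False a by auto
    have "inj_on (s(a := hd p)) (insert a (set p - {last p}))"
    proof (subst inj_on_insert, intro conjI)
      show "inj_on (s(a := hd p)) (set p - {last p})"
        using s(1,2) by (intro inj_on_fun_updI) auto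
      show "(s(a := hd p)) a \<notin> (s(a := hd p)) ` (set p - {last p} - {a})"
        using s(2) by auto
    qed
    moreover have "(s(a := hd p)) ` insert a (set p - {last p}) \<subseteq> set (a # p) - {hd (a # p)}"
      using s(2) a by auto
    moreover have "\<forall>v \<in> insert a (set p - {last p}). (v, (s(a := hd p)) v) \<in> A"
      using s(3) a by auto
    ultimately show ?thesis unfolding eq by blast
  qed
qed

lemma vpath_with_proj:
  "vpath p (with_proj D) \<longleftrightarrow>
    set p \<subseteq> pverts D \<and> set (vwalk_arcs p) \<subseteq> parcs D \<and> p \<noteq> [] \<and> distinct p"
  unfolding vpath_def vwalk_def by (auto simp: arcs_ends_def arc_to_ends_def)

text \<open>The successor maps of the single paths are glued and extended by the identity;
  disjointness of the paths makes the result well defined and injective.\<close>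

lemma linked_if_routing:
  assumes "routing D X T R"
  shows "linked (pverts D) (parcs D) T X"
proof -
  have R: "\<And>p. p \<in> R \<Longrightarrow> distinct p \<and> p \<noteq> [] \<and> set (vwalk_arcs p) \<subseteq> parcs D \<and> set p \<subseteq> pverts D"
    and start: "\<And>x. x \<in> X \<Longrightarrow> \<exists>p \<in> R. hd p = x"
    and target: "\<And>p. p \<in> R \<Longrightarrow> last p \<in> T"
    and disj: "\<And>p q. p \<in> R \<Longrightarrow> q \<in> R \<Longrightarrow> set p \<inter> set q \<noteq> {} \<Longrightarrow> p = q"
    using assms unfolding routing_def vpath_with_proj by blast+
  have "\<forall>p \<in> R. \<exists>s. inj_on s (set p - {last p}) \<and> s ` (set p - {last p}) \<subseteq> set p - {hd p} \<and>
    (\<forall>v \<in> set p - {last p}. (v, s v) \<in> parcs D)"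
    using successor_along_path R by metis
  then obtain s where s: "\<And>p. p \<in> R \<Longrightarrow> inj_on (s p) (set p - {last p})"
      "\<And>p v. p \<in> R \<Longrightarrow> v \<in> set p - {last p} \<Longrightarrow> s p v \<in> set p - {hd p}"
      "\<And>p v. p \<in> R \<Longrightarrow> v \<in> set p - {last p} \<Longrightarrow> (v, s p v) \<in> parcs D"
    by (subst (asm) bchoice_iff) blast
  define \<phi> where "\<phi> v = (if \<exists>p \<in> R. v \<in> set p then s (THE p. p \<in> R \<and> v \<in> set p) v else v)" for v
  have on: "\<phi> v = s p v" if "p \<in> R" "v \<in> set p" for p v
  proof -
    have "(THE p. p \<in> R \<and> v \<in> set p) = p"
      using that disj by (intro the_equality) blast+
    then show ?thesis using that unfolding \<phi>_def by auto
  qed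
  have off: "\<phi> v = v" if "\<not> (\<exists>p \<in> R. v \<in> set p)" for v
    using that unfolding \<phi>_def by auto
  have notlast: "v \<in> set p - {last p}" if "p \<in> R" "v \<in> set p" "v \<notin> T" for p v
    using that target by auto
  have stay: "\<phi> v \<in> set p - {hd p}" if "p \<in> R" "v \<in> set p" "v \<notin> T" for p v
    using on s(2) notlast that by metis
  \<comment> \<open>Off \<open>T\<close>, a vertex lies on a given path exactly if its image does,
    so a collision can only occur within one path or among fixed vertices.\<close>
  have same: "v \<in> set p \<longleftrightarrow> \<phi> v \<in> set p" if "p \<in> R" "v \<notin> T" for p v
  proof (cases "\<exists>q \<in> R. v \<in> set q")
    case True
    then show ?thesis using stay that disj by blast
  qed (use off that in auto)
  show ?thesis
  proof (rule linkedI[of \<phi>])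
    show "inj_on \<phi> (pverts D - T)"
    proof (rule inj_onI)
      fix u v assume uv: "u \<in> pverts D - T" "v \<in> pverts D - T" "\<phi> u = \<phi> v"
      show "u = v"
      proof (cases "\<exists>p \<in> R. u \<in> set p")
        case True
        then obtain p where p: "p \<in> R" "u \<in> set p" by blast
        then have "v \<in> set p" using same uv by (metis DiffD2)
        then show ?thesis using s(1)[OF p(1)] notlast p uv on
          by (metis DiffD2 inj_onD)
      next
        case False
        then have "\<not> (\<exists>p \<in> R. v \<in> set p)" using same uv by (metis DiffD2)
        then show ?thesis using False off uv by metis
      qed
    qed
  next
    fix v assume v: "v \<in> pverts D - T"
    show "\<phi> v \<in> pverts D - X"
    proof (cases "\<exists>p \<in> R. v \<in> set p")
      case True
      then obtain p where p: "p \<in> R" "v \<in> set p" by blast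
      have in_p: "\<phi> v \<in> set p - {hd p}" using stay p v by blast
      \<comment> \<open>A path starting at \<open>\<phi> v\<close> would meet \<open>p\<close> and
        hence be \<open>p\<close>, whose first vertex is not a successor.\<close>
      have "\<phi> v \<notin> X"
      proof
        assume "\<phi> v \<in> X"
        then obtain q where q: "q \<in> R" "hd q = \<phi> v" using start by blast
        then have "\<phi> v \<in> set q" using R by (metis hd_in_set)
        then have "q = p" using disj[OF q(1) p(1)] in_p by blast
        then show False using q in_p by auto
      qed
      then show ?thesis using R[OF p(1)] in_p by blast
    next
      case False
      then show ?thesis using off[OF False] v start R by (metis DiffD1 DiffI hd_in_set)
    qed
    show "\<phi> v = v \<or> (v, \<phi> v) \<in> parcs D"
      using off on s(3) notlast v by (metis DiffD2)
  qed
qed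

lemma vwalk_arcs_map_upt:
  "vwalk_arcs (map g [0..<Suc n]) = map (\<lambda>i. (g i, g (Suc i))) [0..<n]"
proof (induction n)
  case (Suc n)
  have "vwalk_arcs (map g [0..<Suc (Suc n)]) = vwalk_arcs (map g [0..<Suc n] @ [g (Suc n)])"
    by simp
  also have "\<dots> = vwalk_arcs (map g [0..<Suc n]) @ [(g n, g (Suc n))]"
    by (subst vwalk_arcs_append) auto
  finally show ?case using Suc by simp
qed simp

text \<open>The paths are the orbits under \<phi> of the elements of \<open>X\<close>, stopped on
  reaching \<open>T\<close>. As \<phi> is injective and misses \<open>X\<close>, orbits neither
  close up nor merge, and in a finite digraph they have to stop.\<close>

lemma routing_if_linked:
  assumes "finite (pverts D)" "X \<subseteq> pverts D" and lk: "linked (pverts D) (parcs D) T X"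
  shows "\<exists>R. routing D X T R"
proof -
  let ?V = "pverts D"
  obtain \<phi> where inj: "inj_on \<phi> (?V - T)" and miss: "\<And>v. v \<in> ?V - T \<Longrightarrow> \<phi> v \<in> ?V - X"
    and arc: "\<And>v. v \<in> ?V - T \<Longrightarrow> \<phi> v = v \<or> (v, \<phi> v) \<in> parcs D"
    by (rule linkedE[OF lk]) blast
  \<comment> \<open>Equal iterates are traced back by injectivity until one exponent is 0; a
    positive exponent on the other side would make an element of \<open>X\<close> a value of
    \<phi>.\<close>
  have unique: "i = j \<and> x = y"
    if "x \<in> X" "y \<in> X" "\<forall>k<i. (\<phi> ^^ k) x \<in> ?V - T" "\<forall>k<j. (\<phi> ^^ k) y \<in> ?V - T"
      "(\<phi> ^^ i) x = (\<phi> ^^ j) y" for x y i j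
    using that
  proof (induction i arbitrary: j)
    case 0
    then show ?case using miss by (cases j) auto
  next
    case (Suc i)
    show ?case
    proof (cases j)
      case 0
      then show ?thesis using Suc.prems miss by (auto simp: less_Suc_eq)
    next
      case j: (Suc j')
      have "(\<phi> ^^ i) x = (\<phi> ^^ j') y"
        by (rule inj_onD[OF inj]) (use Suc.prems j in auto)
      then have "i = j' \<and> x = y"
        by (intro Suc.IH) (use Suc.prems j in auto)
      then show ?thesis using j by simp
    qed
  qed
  have ex: "\<exists>n. (\<phi> ^^ n) x \<notin> ?V - T" if "x \<in> X" for x
  proof (rule ccontr)
    assume *: "\<nexists>n. (\<phi> ^^ n) x \<notin> ?V - T"
    then have "inj (\<lambda>n. (\<phi> ^^ n) x)"
      using unique[OF that that] by (auto intro: injI)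
    moreover have "range (\<lambda>n. (\<phi> ^^ n) x) \<subseteq> ?V" using * by auto
    ultimately show False using assms(1) by (meson finite_subset infinite_UNIV_nat finite_imageD)
  qed
  define N where "N x = (LEAST n. (\<phi> ^^ n) x \<notin> ?V - T)" for x
  have before: "(\<phi> ^^ k) x \<in> ?V - T" if "k < N x" for k x
    using not_less_Least that unfolding N_def by blast
  have inV: "(\<phi> ^^ k) x \<in> ?V" if "x \<in> X" "k \<le> N x" for k x
  proof (cases k)
    case 0
    then show ?thesis using that assms(2) by auto
  next
    case (Suc k')
    then show ?thesis using miss[OF before[of k' x]] that by auto
  qed
  have end_in: "(\<phi> ^^ N x) x \<in> T" if "x \<in> X" for x
    using LeastI_ex[OF ex[OF that]] inV[OF that order_refl] unfolding N_def by blast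
  have unique': "i = j \<and> x = y"
    if "x \<in> X" "y \<in> X" "i \<le> N x" "j \<le> N y" "(\<phi> ^^ i) x = (\<phi> ^^ j) y" for x y i j
    by (rule unique) (use that before in auto)
  define P where "P x = map (\<lambda>i. (\<phi> ^^ i) x) [0..<Suc (N x)]" for x
  have set_P: "set (P x) = (\<lambda>i. (\<phi> ^^ i) x) ` {..N x}" for x
    unfolding P_def by (auto simp: less_Suc_eq_le image_iff simp del: upt_Suc)
  have "routing D X T (P ` X)"
    unfolding routing_def ball_simps
  proof (intro conjI ballI)
    fix x assume x: "x \<in> X"
    have "distinct (P x)"
      unfolding P_def distinct_map using unique'[OF x x]
      by (auto simp: inj_on_def less_Suc_eq_le simp del: upt_Suc)
    moreover have "set (vwalk_arcs (P x)) \<subseteq> parcs D"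
    proof
      fix e assume "e \<in> set (vwalk_arcs (P x))"
      then obtain i where i: "i < N x" "e = ((\<phi> ^^ i) x, (\<phi> ^^ Suc i) x)"
        unfolding P_def vwalk_arcs_map_upt by auto
      \<comment> \<open>Staying in place would repeat a vertex of the orbit, so \<phi> moves along
        an arc here.\<close>
      moreover have "(\<phi> ^^ i) x \<noteq> (\<phi> ^^ Suc i) x"
        using unique'[OF x x, of i "Suc i"] i by auto
      ultimately show "e \<in> parcs D" using arc[OF before[OF i(1)]] by auto
    qed
    moreover have "set (P x) \<subseteq> ?V" using inV x by (auto simp: set_P)
    moreover have "P x \<noteq> []" by (simp add: P_def)
    ultimately show "vpath (P x) (with_proj D)" unfolding vpath_with_proj by blast
    show "\<exists>p \<in> P ` X. hd p = x"
      using x by (intro bexI[of _ "P x"]) (auto simp: P_def hd_map simp del: upt_Suc)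
    show "last (P x) \<in> T" using end_in[OF x] by (simp add: P_def)
    fix y assume y: "y \<in> X"
    show "P x = P y \<or> set (P x) \<inter> set (P y) = {}"
      using unique'[OF x y] unfolding set_P by fastforce
  qed
  then show ?thesis by blast
qed

lemma gammoid_of_linked:
  assumes "pair_fin_digraph D" "E \<subseteq> pverts D"
  shows "gammoid_of D T E =
    \<lparr>ground = E, indeps = {X. X \<subseteq> E \<and> linked (pverts D) (parcs D) T X}\<rparr>"
proof -
  have "finite (pverts D)" using assms(1) by (rule pair_fin_digraph.pair_finite_verts)
  then have "(\<exists>R. routing D X T R) \<longleftrightarrow> linked (pverts D) (parcs D) T X" if "X \<subseteq> E" for X
    using linked_if_routing routing_if_linked that assms(2) by (metis subset_trans)
  then show ?thesis unfolding gammoid_of_def by auto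
qed

section \<open>Standard representations\<close>

text \<open>The conditions of \<open>standard_representation\<close> that do not mention the
  matroid, on bare vertex and arc sets, so that digraphs can be reversed, relabelled and united
  directly.\<close>

definition std_digraph :: "'a set \<Rightarrow> 'a rel \<Rightarrow> 'a set \<Rightarrow> 'a set \<Rightarrow> bool" where
  "std_digraph V A T E \<longleftrightarrow> finite V \<and> A \<subseteq> V \<times> V \<and> T \<subseteq> E \<and> E \<subseteq> V \<and>
    (\<forall>t \<in> T. \<forall>w. (t, w) \<notin> A) \<and> (\<forall>e \<in> E - T. \<forall>u. (u, e) \<notin> A)"

definition linkage_system :: "'a set \<Rightarrow> 'a rel \<Rightarrow> 'a set \<Rightarrow> 'a set \<Rightarrow> 'a indep_system" where
  "linkage_system V A T E = \<lparr>ground = E, indeps = {X. X \<subseteq> E \<and> linked V A T X}\<rparr>"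

lemma linkage_system_simps [simp]:
  "ground (linkage_system V A T E) = E"
  "X \<in> indeps (linkage_system V A T E) \<longleftrightarrow> X \<subseteq> E \<and> linked V A T X"
  unfolding linkage_system_def by auto

lemma standard_representation_iff:
  "standard_representation D T E M \<longleftrightarrow>
    std_digraph (pverts D) (parcs D) T E \<and> M = linkage_system (pverts D) (parcs D) T E"
proof -
  have "pair_fin_digraph D \<longleftrightarrow> finite (pverts D) \<and> parcs D \<subseteq> pverts D \<times> pverts D"
  proof
    assume "pair_fin_digraph D"
    then interpret pair_fin_digraph D .
    show "finite (pverts D) \<and> parcs D \<subseteq> pverts D \<times> pverts D"
      using pair_finite_verts in_arcsD1 in_arcsD2 by auto
  next
    assume *: "finite (pverts D) \<and> parcs D \<subseteq> pverts D \<times> pverts D"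
    then have "finite (parcs D)" by (meson finite_SigmaI finite_subset)
    then show "pair_fin_digraph D"
      using * by unfold_locales auto
  qed
  then show ?thesis
    unfolding standard_representation_def representation_def std_digraph_def source_def sink_def
    by (cases "pair_fin_digraph D \<and> E \<subseteq> pverts D")
      (auto simp: gammoid_of_linked linkage_system_def)
qed

definition pivot_arcs :: "'a set \<Rightarrow> ('a \<Rightarrow> 'a) \<Rightarrow> 'a rel \<Rightarrow> 'a rel" where
  "pivot_arcs S \<phi> A = {(\<phi> v, u) | v u. v \<in> S \<and> u \<noteq> \<phi> v \<and> (u = v \<or> (v, u) \<in> A)}"

text \<open>Reindexing the non-targets along a linking \<open>\<phi>\<close> moves the target set from \<open>T\<close> to the set of
  vertices missed by \<open>\<phi>\<close>; this replaces Mason's sequence of arc pivots.\<close>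

lemma linked_pivot:
  assumes inj: "inj_on \<phi> (V - T)" and sub: "\<phi> ` (V - T) \<subseteq> V"
    and arc: "\<And>v. v \<in> V - T \<Longrightarrow> \<phi> v = v \<or> (v, \<phi> v) \<in> A"
  shows "linked V (pivot_arcs (V - T) \<phi> A) (V - \<phi> ` (V - T)) X \<longleftrightarrow> linked V A T X"
proof -
  let ?S = "V - T"
  have dom: "V - (V - \<phi> ` ?S) = \<phi> ` ?S" using sub by blast
  show ?thesis
  proof
    assume "linked V (pivot_arcs ?S \<phi> A) (V - \<phi> ` ?S) X"
    then obtain \<psi> where \<psi>: "inj_on \<psi> (\<phi> ` ?S)" "\<And>v. v \<in> \<phi> ` ?S \<Longrightarrow> \<psi> v \<in> V - X"
      "\<And>v. v \<in> \<phi> ` ?S \<Longrightarrow> \<psi> v = v \<or> (v, \<psi> v) \<in> pivot_arcs ?S \<phi> A"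
      by (rule linkedE) (auto simp: dom)
    show "linked V A T X"
    proof (rule linkedI[of "\<psi> \<circ> \<phi>"])
      show "inj_on (\<psi> \<circ> \<phi>) ?S" using inj \<psi>(1) by (rule comp_inj_on)
      fix v assume v: "v \<in> ?S"
      show "(\<psi> \<circ> \<phi>) v \<in> V - X" using \<psi>(2) v by simp
      show "(\<psi> \<circ> \<phi>) v = v \<or> (v, (\<psi> \<circ> \<phi>) v) \<in> A"
      proof (cases "\<psi> (\<phi> v) = \<phi> v")
        case True
        then show ?thesis using arc[OF v] by simp
      next
        case False
        then obtain u where "u \<in> ?S" "\<phi> u = \<phi> v" "\<psi> (\<phi> v) = u \<or> (u, \<psi> (\<phi> v)) \<in> A"
          using \<psi>(3)[of "\<phi> v"] v unfolding pivot_arcs_def by auto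
        then show ?thesis using inj_onD[OF inj _ _ v] by auto
      qed
    qed
  next
    assume "linked V A T X"
    then obtain \<psi> where \<psi>: "inj_on \<psi> ?S" "\<And>v. v \<in> ?S \<Longrightarrow> \<psi> v \<in> V - X"
      "\<And>v. v \<in> ?S \<Longrightarrow> \<psi> v = v \<or> (v, \<psi> v) \<in> A"
      by (rule linkedE) blast
    let ?i = "inv_into ?S \<phi>"
    show "linked V (pivot_arcs ?S \<phi> A) (V - \<phi> ` ?S) X"
    proof (rule linkedI[of "\<psi> \<circ> ?i"], unfold dom)
      show "inj_on (\<psi> \<circ> ?i) (\<phi> ` ?S)"
        using \<psi>(1) by (intro comp_inj_on inj_on_inv_into) (auto simp: inj inj_on_def inv_into_f_f[OF inj])
      fix w assume "w \<in> \<phi> ` ?S"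
      then obtain v where v: "v \<in> ?S" "w = \<phi> v" by blast
      then have i: "?i w = v" using inj by simp
      show "(\<psi> \<circ> ?i) w \<in> V - X" using \<psi>(2) v i by simp
      show "(\<psi> \<circ> ?i) w = w \<or> (w, (\<psi> \<circ> ?i) w) \<in> pivot_arcs ?S \<phi> A"
        using \<psi>(3)[OF v(1)] v i unfolding pivot_arcs_def by auto
    qed
  qed
qed

text \<open>No arc leaves \<open>U\<close>, so a linking of \<open>V\<close> maps
  \<open>U - T\<close> into \<open>U\<close>; conversely a linking of \<open>U\<close> is extended
  by the identity. Applied both to the part reachable from the ground set and to the components of a
  disjoint union.\<close>

lemma linked_restrict_verts:
  assumes "U \<subseteq> V" "A `` U \<subseteq> U" "X \<subseteq> U" "T \<subseteq> V"
  shows "linked U (A \<inter> U \<times> U) (T \<inter> U) X \<longleftrightarrow> linked V A T X"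
proof
  assume "linked V A T X"
  then obtain \<phi> where \<phi>: "inj_on \<phi> (V - T)" "\<And>v. v \<in> V - T \<Longrightarrow> \<phi> v \<in> V - X"
    "\<And>v. v \<in> V - T \<Longrightarrow> \<phi> v = v \<or> (v, \<phi> v) \<in> A"
    by (rule linkedE) blast
  have "\<phi> v \<in> U" if "v \<in> U - T" for v
  proof (cases "\<phi> v = v")
    case False
    then have "(v, \<phi> v) \<in> A" using \<phi>(3)[of v] that assms(1) by blast
    then show ?thesis using that assms(2) by blast
  qed (use that in simp)
  then show "linked U (A \<inter> U \<times> U) (T \<inter> U) X"
    using \<phi> assms(1) by (intro linkedI[of \<phi>]) (auto intro: inj_on_subset)
next
  assume "linked U (A \<inter> U \<times> U) (T \<inter> U) X"
  then obtain \<phi> where \<phi>: "inj_on \<phi> (U - T \<inter> U)" "\<And>v. v \<in> U - T \<inter> U \<Longrightarrow> \<phi> v \<in> U - X"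
    "\<And>v. v \<in> U - T \<inter> U \<Longrightarrow> \<phi> v = v \<or> (v, \<phi> v) \<in> A \<inter> U \<times> U"
    by (rule linkedE) blast
  show "linked V A T X"
  proof (rule linkedI[of "\<lambda>v. if v \<in> U then \<phi> v else v"])
    show "inj_on (\<lambda>v. if v \<in> U then \<phi> v else v) (V - T)"
    proof (rule inj_onI)
      fix u v assume *: "u \<in> V - T" "v \<in> V - T"
        "(if u \<in> U then \<phi> u else u) = (if v \<in> U then \<phi> v else v)"
      then show "u = v"
        using \<phi>(2)[of u] \<phi>(2)[of v] inj_onD[OF \<phi>(1), of u v] by (auto split: if_splits)
    qed
  qed (use \<phi> assms in auto)
qed

text \<open>The identity links \<open>T\<close> itself. Shifting along a path from \<open>e\<close>
  to \<open>b\<close> exchanges \<open>b\<close> for \<open>e\<close> in the set of missed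
  vertices.\<close>

lemma linked_insert_reachable:
  assumes "(e, b) \<in> A\<^sup>*" "A \<subseteq> V \<times> V" "e \<in> V" "b \<in> T" "B \<subseteq> T - {b}"
    and sink: "\<And>t w. t \<in> T \<Longrightarrow> (t, w) \<notin> A"
  shows "linked V A T (insert e B)"
proof -
  let ?D = "\<lparr>pverts = V, parcs = A\<rparr>"
  have "\<exists>p. vwalk p (with_proj ?D) \<and> hd p = e \<and> last p = b"
    using assms(1,3)
  proof (induction rule: converse_rtrancl_induct)
    case base
    then show ?case by (intro exI[of _ "[b]"]) auto
  next
    case (step u v)
    then obtain p where p: "vwalk p (with_proj ?D)" "hd p = v" "last p = b"
      using assms(2) by blast
    then have "vwalk (u # p) (with_proj ?D)"
      using step by (intro vwalk_consI) (auto simp: arcs_ends_def arc_to_ends_def)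
    moreover have "p \<noteq> []" using p(1) by (simp add: vwalk_def)
    ultimately show ?case using p by (intro exI[of _ "u # p"]) auto
  qed
  then obtain p where p: "vpath p (with_proj ?D)" "hd p = e" "last p = b"
    using vwalk_to_vpath_vpath vwalk_to_vpath_hd vwalk_to_vpath_last by metis
  then have p': "distinct p" "p \<noteq> []" "set (vwalk_arcs p) \<subseteq> A" "set p \<subseteq> V"
    unfolding vpath_with_proj by auto
  obtain s where s: "inj_on s (set p - {b})" "s ` (set p - {b}) \<subseteq> set p - {e}"
      "\<forall>v \<in> set p - {b}. (v, s v) \<in> A"
    using successor_along_path[OF p'(1-3)] p by auto
  \<comment> \<open>All vertices of the path before \<open>b\<close> have a successor and are
    therefore not sinks; so the shift leaves the other targets missed.\<close>
  have p_T: "set p \<inter> T = {b}"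
    using s(3) sink assms(4) last_in_set[OF p'(2)] p(3) by blast
  show ?thesis
  proof (rule linkedI[of "\<lambda>v. if v \<in> set p then s v else v"])
    show "inj_on (\<lambda>v. if v \<in> set p then s v else v) (V - T)"
    proof (rule inj_onI)
      fix u v assume *: "u \<in> V - T" "v \<in> V - T"
        "(if u \<in> set p then s u else u) = (if v \<in> set p then s v else v)"
      then have "u \<noteq> b" "v \<noteq> b" using assms(4) by auto
      then show "u = v"
        using * s(2) inj_onD[OF s(1), of u v] by (auto split: if_splits)
    qed
  next
    fix v assume v: "v \<in> V - T"
    then have "v \<noteq> b" using assms(4) by auto
    show "(if v \<in> set p then s v else v) \<in> V - insert e B"
    proof (cases "v \<in> set p")
      case True
      then have "s v \<in> set p - {e}" using s(2) \<open>v \<noteq> b\<close> by auto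
      then show ?thesis using True p_T assms(5) p'(4) by auto
    next
      case False
      then have "v \<noteq> e" using p(2) p'(2) by auto
      then show ?thesis using False v assms(5) by auto
    qed
    show "(if v \<in> set p then s v else v) = v \<or> (v, if v \<in> set p then s v else v) \<in> A"
      using s(3) \<open>v \<noteq> b\<close> by auto
  qed
qed

section \<open>Fresh vertices and the existence of standard representations\<close>

lemma ex_inj_avoiding:
  fixes F :: "'a::infinite set"
  assumes "finite S" "finite F"
  obtains g :: "'a \<Rightarrow> 'a" where "inj_on g S" "g ` S \<inter> F = {}"
proof -
  \<comment> \<open>This is where the infinite vertex type supplies fresh names.\<close>
  have "infinite (UNIV - F)" using assms(2) infinite_UNIV by simp
  then obtain C where C: "C \<subseteq> UNIV - F" "finite C" "card C = card S"
    using infinite_arbitrarily_large by blast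
  then obtain g where "bij_betw g S C" using assms(1) finite_same_card_bij by metis
  then show ?thesis using C(1) that[of g] by (auto simp: bij_betw_def)
qed

lemma ex_relabelling:
  fixes F :: "'a::infinite set"
  assumes "finite V" "finite F"
  obtains h :: "'a \<Rightarrow> 'a" where "inj_on h V" "\<And>v. v \<in> K \<Longrightarrow> h v = v" "h ` (V - K) \<inter> F = {}"
proof -
  obtain g :: "'a \<Rightarrow> 'a" where g: "inj_on g (V - K)" "g ` (V - K) \<inter> (F \<union> (V \<inter> K)) = {}"
    using ex_inj_avoiding[of "V - K" "F \<union> (V \<inter> K)"] assms by auto
  show ?thesis
  proof (rule that[of "\<lambda>v. if v \<in> K then v else g v"])
    show "inj_on (\<lambda>v. if v \<in> K then v else g v) V"
    proof (rule inj_onI)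
      fix u v assume "u \<in> V" "v \<in> V" "(if u \<in> K then u else g u) = (if v \<in> K then v else g v)"
      then show "u = v"
        using g(2) inj_onD[OF g(1), of u v] by (auto split: if_splits)
    qed
  qed (use g in auto)
qed

text \<open>With the targets already sinks inside \<open>E\<close>, what remains is to turn
  \<open>E - B\<close> into sources. A new vertex placed in front of the old one does this, at the
  cost of one arc each.\<close>

lemma std_digraph_of_sinks:
  fixes V :: "'a::infinite set"
  assumes fin: "finite V" and A: "A \<subseteq> V \<times> V" and B: "B \<subseteq> E" "E \<subseteq> V"
    and sink: "\<And>b w. b \<in> B \<Longrightarrow> (b, w) \<notin> A"
  obtains V' A' where "std_digraph V' A' B E"
    "\<And>X. X \<subseteq> E \<Longrightarrow> linked V' A' B X \<longleftrightarrow> linked V A B X"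
proof -
  obtain h :: "'a \<Rightarrow> 'a" where h: "inj_on h V" "\<And>v. v \<in> B \<Longrightarrow> h v = v" "h ` (V - B) \<inter> E = {}"
    using ex_relabelling[of V E B] fin B by (metis finite_subset)
  \<comment> \<open>Every \<open>e \<in> E - B\<close> is replaced by a copy \<open>h e\<close> and becomes a source with the single arc to it.\<close>
  define V' where "V' = h ` V \<union> E"
  define A' where "A' = {(h u, h v) | u v. (u, v) \<in> A} \<union> (\<lambda>e. (e, h e)) ` (E - B)"
  have hE: "h u \<in> E \<longleftrightarrow> u \<in> B" if "u \<in> V" for u
    using h that B by auto
  have hh: "h u = h v \<longleftrightarrow> u = v" if "u \<in> V" "v \<in> V" for u v
    using inj_onD[OF h(1)] that by blast
  have V'B: "V' - B = h ` (V - B) \<union> (E - B)"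
    unfolding V'_def using h(2) hE B by fastforce
  have arc_h: "(h u, w) \<in> A' \<longleftrightarrow> (\<exists>v. w = h v \<and> (u, v) \<in> A)" if "u \<in> V - B" for u w
    unfolding A'_def using that hE[of u] hh A by auto
  have arc_E: "(e, w) \<in> A' \<longleftrightarrow> w = h e" if "e \<in> E - B" for e w
  proof -
    have "e \<notin> h ` V" using that hE h(2) by auto
    then have "(e, w) \<notin> {(h u, h v) | u v. (u, v) \<in> A}" using A by blast
    then show ?thesis unfolding A'_def using that by auto
  qed
  have std: "std_digraph V' A' B E"
    unfolding std_digraph_def
  proof (intro conjI ballI allI)
    show "finite V'" unfolding V'_def using fin B finite_subset by auto
    show "A' \<subseteq> V' \<times> V'" using A B unfolding A'_def V'_def by auto
    show "B \<subseteq> E" "E \<subseteq> V'" using B by (auto simp: V'_def)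
    show "(t, w) \<notin> A'" if t: "t \<in> B" for t w
    proof
      assume "(t, w) \<in> A'"
      then obtain u v where uv: "t = h u" "(u, v) \<in> A" using t unfolding A'_def by auto
      then have "u \<in> B" using hE[of u] A t B by auto
      then show False using sink uv by blast
    qed
    show "(u, e) \<notin> A'" if e: "e \<in> E - B" for e u
    proof
      assume "(u, e) \<in> A'"
      then obtain v where v: "e = h v" "v \<in> V" using A B unfolding A'_def by auto
      then show False using e hE[of v] h(2)[of v] by auto
    qed
  qed
  have "linked V' A' B X \<longleftrightarrow> linked V A B X" if X: "X \<subseteq> E" for X
  proof
    assume "linked V A B X"
    then obtain \<phi> where \<phi>: "inj_on \<phi> (V - B)" "\<And>v. v \<in> V - B \<Longrightarrow> \<phi> v \<in> V - X"
      "\<And>v. v \<in> V - B \<Longrightarrow> \<phi> v = v \<or> (v, \<phi> v) \<in> A"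
      by (rule linkedE) blast
    \<comment> \<open>Copies follow the old linking. A new source \<open>e\<close> stays unless it
      must be vacated, and then it steps to its copy \<open>h e\<close>; that copy is free because
      \<phi> misses \<open>X\<close>.\<close>
    define \<psi> where "\<psi> w = (if w \<in> E then if w \<in> X then h w else w else h (\<phi> (inv_into V h w)))" for w
    have \<psi>E: "\<psi> e = (if e \<in> X then h e else e)" if "e \<in> E - B" for e
      using that unfolding \<psi>_def by auto
    have \<psi>h: "\<psi> (h v) = h (\<phi> v)" if "v \<in> V - B" for v
      using that hE[of v] h(1) unfolding \<psi>_def by auto
    have hX: "h (\<phi> v) \<notin> X" if "v \<in> V - B" for v
      using \<phi>(2)[OF that] hE[of "\<phi> v"] h(2)[of "\<phi> v"] X by auto
    show "linked V' A' B X"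
    proof (rule linkedI[of \<psi>])
      show "inj_on \<psi> (V' - B)"
      proof (unfold V'B, rule inj_on_Un[THEN iffD2], intro conjI)
        show "inj_on \<psi> (h ` (V - B))"
        proof (rule inj_onI, elim imageE)
          fix u v u' v' assume *: "\<psi> u' = \<psi> v'" "u' = h u" "v' = h v" "u \<in> V - B" "v \<in> V - B"
          then have "\<phi> u = \<phi> v" using \<psi>h hh[of "\<phi> u" "\<phi> v"] \<phi>(2) by auto
          then show "u' = v'" using inj_onD[OF \<phi>(1)] * by auto
        qed
        show "inj_on \<psi> (E - B)"
        proof (rule inj_onI)
          fix x y assume xy: "x \<in> E - B" "y \<in> E - B" "\<psi> x = \<psi> y"
          then have "x \<in> V" "y \<in> V" using B by auto
          then show "x = y" using xy \<psi>E hE hh by (auto split: if_splits)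
        qed
        show "\<psi> ` (h ` (V - B) - (E - B)) \<inter> \<psi> ` (E - B - h ` (V - B)) = {}"
        proof -
          have "\<psi> (h v) \<noteq> \<psi> e" if v: "v \<in> V - B" and e: "e \<in> E - B" for v e
          proof (cases "e \<in> X")
            case True
            then have "\<phi> v \<noteq> e" using \<phi>(2)[OF v] by auto
            then show ?thesis using True \<psi>h[OF v] \<psi>E[OF e] hh[of "\<phi> v" e] \<phi>(2)[OF v] e B by auto
          next
            case False
            then show ?thesis
              using \<psi>h[OF v] \<psi>E[OF e] hE[of "\<phi> v"] h(2)[of "\<phi> v"] \<phi>(2)[OF v] e by auto
          qed
          then show ?thesis by blast
        qed
      qed
    next
      fix w assume "w \<in> V' - B"
      then consider v where "v \<in> V - B" "w = h v" | "w \<in> E - B" unfolding V'B by blast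
      then have "\<psi> w \<in> V' - X \<and> (\<psi> w = w \<or> (w, \<psi> w) \<in> A')"
      proof cases
        case 1
        then show ?thesis
          using \<psi>h[OF 1(1)] \<phi>(2,3)[OF 1(1)] arc_h[OF 1(1)] hX[OF 1(1)] by (auto simp: V'_def)
      next
        case 2
        then show ?thesis
          using \<psi>E[OF 2] arc_E[OF 2] hE[of w] X B by (auto simp: V'_def)
      qed
      then show "\<psi> w \<in> V' - X" "\<psi> w = w \<or> (w, \<psi> w) \<in> A'" by auto
    qed
  next
    assume "linked V' A' B X"
    then obtain \<psi> where \<psi>: "inj_on \<psi> (V' - B)" "\<And>v. v \<in> V' - B \<Longrightarrow> \<psi> v \<in> V' - X"
      "\<And>v. v \<in> V' - B \<Longrightarrow> \<psi> v = v \<or> (v, \<psi> v) \<in> A'"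
      by (rule linkedE) blast
    have "\<forall>v \<in> V - B. \<exists>u. u \<in> V \<and> \<psi> (h v) = h u \<and> (u = v \<or> (v, u) \<in> A)"
    proof
      fix v assume v: "v \<in> V - B"
      then have "h v \<in> V' - B" using V'B by blast
      then consider "\<psi> (h v) = h v" | u where "\<psi> (h v) = h u" "(v, u) \<in> A"
        using \<psi>(3) arc_h[OF v] by blast
      then show "\<exists>u. u \<in> V \<and> \<psi> (h v) = h u \<and> (u = v \<or> (v, u) \<in> A)"
        using v A by cases blast+
    qed
    then obtain \<phi> where \<phi>: "\<And>v. v \<in> V - B \<Longrightarrow> \<phi> v \<in> V \<and> \<psi> (h v) = h (\<phi> v) \<and> (\<phi> v = v \<or> (v, \<phi> v) \<in> A)"
      by metis
    have hV': "h v \<in> V' - B" if "v \<in> V - B" for v using that V'B by blast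
    show "linked V A B X"
    proof (rule linkedI[of \<phi>])
      show "inj_on \<phi> (V - B)"
      proof (rule inj_onI)
        fix u v assume uv: "u \<in> V - B" "v \<in> V - B" "\<phi> u = \<phi> v"
        then have "\<psi> (h u) = \<psi> (h v)" using \<phi>[of u] \<phi>[of v] by simp
        then have "h u = h v" using inj_onD[OF \<psi>(1)] hV' uv by blast
        then show "u = v" using hh uv by blast
      qed
      fix v assume v: "v \<in> V - B"
      show "\<phi> v = v \<or> (v, \<phi> v) \<in> A" using \<phi> v by blast
      have "\<phi> v \<notin> X"
      proof
        assume eX: "\<phi> v \<in> X"
        show False
        proof (cases "\<phi> v \<in> B")
          case True
          then show False using \<psi>(2)[OF hV'[OF v]] \<phi>[OF v] h(2) eX by auto
        next
          case False
          then have e: "\<phi> v \<in> E - B" using eX X by auto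
          then have eV': "\<phi> v \<in> V' - B" using V'B by blast
          \<comment> \<open>The source \<open>\<phi> v\<close> lies in \<open>X\<close> and cannot
            stay, and its only arc leads to its copy. That copy is already the image of
            \<open>h v\<close>, contradicting injectivity.\<close>
          have "\<psi> (\<phi> v) = h (\<phi> v)"
            using \<psi>(2,3)[OF eV'] arc_E[OF e] eX by (metis DiffD2)
          then have "\<phi> v = h v" using inj_onD[OF \<psi>(1) _ eV' hV'[OF v]] \<phi>[OF v] by metis
          then show False using e hE[of v] v by auto
        qed
      qed
      then show "\<phi> v \<in> V - X" using \<phi> v by blast
    qed
  qed
  then show ?thesis using that std by blast
qed

text \<open>Pivoting along a linking of a maximal independent set \<open>B\<close> turns the
  elements of \<open>B\<close> into targets that are sinks. Targets other than \<open>B\<close> are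
  then cut off, and \<open>E - B\<close> is turned into sources.\<close>

lemma ex_std_digraph:
  fixes V :: "'a::infinite set"
  assumes fin: "finite V" and A: "A \<subseteq> V \<times> V" and T: "T \<subseteq> V" and E: "E \<subseteq> V"
  obtains V' A' B where "std_digraph V' A' B E" "linkage_system V' A' B E = linkage_system V A T E"
proof -
  let ?I = "indeps (linkage_system V A T E)"
  have "linked V A T {}" using linked_target linked_subset by blast
  then have "{} \<in> ?I" by simp
  moreover have "finite ?I"
    by (rule finite_subset[of _ "Pow E"]) (use fin E finite_subset in auto)
  ultimately obtain B where B: "B \<in> ?I" "\<And>I. I \<in> ?I \<Longrightarrow> B \<subseteq> I \<Longrightarrow> I = B"
    using finite_has_maximal[of ?I] by (metis empty_iff)
  then obtain \<phi> where \<phi>: "inj_on \<phi> (V - T)" "\<And>v. v \<in> V - T \<Longrightarrow> \<phi> v \<in> V - B"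
    "\<And>v. v \<in> V - T \<Longrightarrow> \<phi> v = v \<or> (v, \<phi> v) \<in> A"
    by (auto elim: linkedE)
  define A1 where "A1 = pivot_arcs (V - T) \<phi> A"
  define B1 where "B1 = V - \<phi> ` (V - T)"
  have lk1: "linked V A1 B1 X \<longleftrightarrow> linked V A T X" for X
    unfolding A1_def B1_def using \<phi> by (intro linked_pivot) auto
  have A1: "A1 \<subseteq> V \<times> V" unfolding A1_def pivot_arcs_def using \<phi>(2) A by auto
  have sink1: "(b, w) \<notin> A1" if "b \<in> B1" for b w
    using that unfolding A1_def B1_def pivot_arcs_def by auto
  have BB1: "B \<subseteq> B1" using B(1) E \<phi>(2) unfolding B1_def by auto
  \<comment> \<open>By maximality of \<open>B\<close>, no element of \<open>E\<close> reaches a target in \<open>B1\<close> outside \<open>B\<close>, so restricting to the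
    vertices reachable from \<open>E\<close> makes the superfluous targets disappear.\<close>
  define U where "U = A1\<^sup>* `` E"
  have EU: "E \<subseteq> U" unfolding U_def by auto
  have "U \<subseteq> V"
  proof
    fix v assume "v \<in> U"
    then obtain e where "e \<in> E" "(e, v) \<in> A1\<^sup>*" unfolding U_def by auto
    from this(2) show "v \<in> V"
      by (cases rule: rtranclE) (use A1 E \<open>e \<in> E\<close> in auto)
  qed
  have closed: "A1 `` U \<subseteq> U" unfolding U_def by (auto intro: rtrancl_into_rtrancl)
  have UB: "B1 \<inter> U = B"
  proof (intro equalityI subsetI)
    fix b assume b: "b \<in> B1 \<inter> U"
    show "b \<in> B"
    proof (rule ccontr)
      assume "b \<notin> B"
      obtain e where e: "e \<in> E" "(e, b) \<in> A1\<^sup>*" using b unfolding U_def by auto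
      have "linked V A1 B1 (insert e B)"
        using e A1 E b BB1 \<open>b \<notin> B\<close> sink1 by (intro linked_insert_reachable) auto
      then have "insert e B = B" using B e by (intro B(2)) (auto simp: lk1)
      then have "e \<in> B" by blast
      then have "e = b" using e(2) sink1 BB1 by (metis converse_rtranclE subsetD)
      then show False using \<open>e \<in> B\<close> \<open>b \<notin> B\<close> by blast
    qed
  qed (use B(1) BB1 EU in auto)
  obtain V' A' where std: "std_digraph V' A' B E"
    and lk': "\<And>X. X \<subseteq> E \<Longrightarrow> linked V' A' B X \<longleftrightarrow> linked U (A1 \<inter> U \<times> U) B X"
  proof (rule std_digraph_of_sinks[of U "A1 \<inter> U \<times> U" B E])
    show "finite U" using \<open>U \<subseteq> V\<close> fin finite_subset by blast
  qed (use B(1) EU BB1 sink1 in auto)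
  have "linked V' A' B X \<longleftrightarrow> linked V A T X" if "X \<subseteq> E" for X
    using lk'[OF that] linked_restrict_verts[OF \<open>U \<subseteq> V\<close> closed, of X B1] that EU lk1 UB
    unfolding B1_def by auto
  then have "linkage_system V' A' B E = linkage_system V A T E"
    unfolding linkage_system_def by auto
  then show ?thesis using that std by blast
qed

section \<open>Duals, minors and direct sums of matroids\<close>

lemma ground_simps [simp]:
  "ground (restriction M X) = X" "ground (dual_matroid M) = ground M"
  "ground (contraction M X) = X" "ground (direct_sum M N) = ground M \<union> ground N"
  by (auto simp: restriction_def dual_matroid_def contraction_def direct_sum_def)

lemma indeps_restriction [simp]: "I \<in> indeps (restriction M X) \<longleftrightarrow> I \<in> indeps M \<and> I \<subseteq> X"
  by (simp add: restriction_def)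

lemma indeps_dual:
  "I \<in> indeps (dual_matroid M) \<longleftrightarrow> I \<subseteq> ground M \<and> (\<exists>B \<in> bases M. I \<inter> B = {})"
  by (simp add: dual_matroid_def)

lemma indep_system_eqI:
  fixes M N :: "'a indep_system"
  assumes "ground M = ground N" "\<And>I. I \<in> indeps M \<longleftrightarrow> I \<in> indeps N"
  shows "M = N"
  using assms by (intro indep_system.equality) auto

lemma restriction_restriction: "X \<subseteq> Y \<Longrightarrow> restriction (restriction M Y) X = restriction M X"
  by (rule indep_system_eqI) auto

lemma bases_indep: "B \<in> bases M \<Longrightarrow> B \<in> indeps M"
  by (simp add: bases_def)

lemma bases_maximal: "B \<in> bases M \<Longrightarrow> I \<in> indeps M \<Longrightarrow> B \<subseteq> I \<Longrightarrow> I = B"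
  by (simp add: bases_def)

section \<open>Bases, duality and minors of a matroid\<close>

context matroid
begin

lemma finite_indep: "I \<in> indeps M \<Longrightarrow> finite I"
  using finite_ground indeps_ground finite_subset by blast

lemma bases_iff_card: "B \<in> bases M \<longleftrightarrow> B \<in> indeps M \<and> (\<forall>I \<in> indeps M. card I \<le> card B)"
proof
  assume B: "B \<in> bases M"
  have "card I \<le> card B" if "I \<in> indeps M" for I
  proof (rule ccontr)
    assume "\<not> card I \<le> card B"
    then obtain x where "x \<in> I - B" "insert x B \<in> indeps M"
      using augment[OF bases_indep[OF B] \<open>I \<in> indeps M\<close>] by auto
    then show False using bases_maximal[OF B] by blast
  qed
  then show "B \<in> indeps M \<and> (\<forall>I \<in> indeps M. card I \<le> card B)" using bases_indep[OF B] by blast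
next
  assume "B \<in> indeps M \<and> (\<forall>I \<in> indeps M. card I \<le> card B)"
  then show "B \<in> bases M"
    unfolding bases_def using finite_indep card_seteq[of _ B] by blast
qed

lemma bases_card: "B \<in> bases M \<Longrightarrow> C \<in> bases M \<Longrightarrow> card B = card C"
  by (simp add: bases_iff_card le_antisym)

lemma ex_basis_above:
  assumes "I \<in> indeps M"
  shows "\<exists>B \<in> bases M. I \<subseteq> B"
proof -
  have "finite (indeps M)"
    using finite_ground indeps_ground by (meson PowI finite_Pow_iff finite_subset subsetI)
  then obtain B where "B \<in> indeps M" "I \<subseteq> B" "\<And>J. J \<in> indeps M \<Longrightarrow> B \<subseteq> J \<Longrightarrow> J = B"
    using finite_has_maximal2[OF _ assms] by metis
  then show ?thesis unfolding bases_def by blast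
qed

lemma matroid_restriction:
  assumes "X \<subseteq> ground M"
  shows "matroid (restriction M X)"
proof
  fix I J assume *: "I \<in> indeps (restriction M X)" "J \<in> indeps (restriction M X)" "card I < card J"
  then show "\<exists>x \<in> J - I. insert x I \<in> indeps (restriction M X)"
    using augment[of I J] by auto
qed (use assms finite_ground finite_subset empty_indep indep_subset in auto)

text \<open>A basis of the restriction to \<open>I \<union> C\<close> has at least as many elements
  as \<open>C\<close>, hence is a basis of the whole matroid.\<close>

lemma ex_basis_between:
  assumes "I \<in> indeps M" "C \<in> bases M"
  shows "\<exists>B \<in> bases M. I \<subseteq> B \<and> B \<subseteq> I \<union> C"
proof -
  have sub: "I \<union> C \<subseteq> ground M" using assms bases_indep indeps_ground by blast
  interpret R: matroid "restriction M (I \<union> C)" using sub by (rule matroid_restriction)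
  obtain B where B: "B \<in> bases (restriction M (I \<union> C))" "I \<subseteq> B"
    using R.ex_basis_above[of I] assms(1) by auto
  then have "card C \<le> card B"
    using R.bases_iff_card[of B] bases_indep[OF assms(2)] by auto
  then have "B \<in> bases M"
    using assms(2) bases_indep[OF B(1)] unfolding bases_iff_card by auto
  then show ?thesis using B bases_indep[OF B(1)] by auto
qed

text \<open>For augmentation, \<open>B - I\<close> is completed by elements of \<open>C\<close> to a
  basis \<open>B'\<close> that still avoids \<open>I\<close>. If \<open>B'\<close> contained all of
  \<open>J - I\<close>, comparing its size with that of \<open>B\<close> would give at most
  \<open>card (I - J)\<close> elements in \<open>J - I\<close>; so some element of
  \<open>J - I\<close> can join \<open>I\<close>.\<close>

lemma matroid_dual: "matroid (dual_matroid M)"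
proof
  show "finite (ground (dual_matroid M))" using finite_ground by simp
  show "I \<subseteq> ground (dual_matroid M)" if "I \<in> indeps (dual_matroid M)" for I
    using that by (simp add: indeps_dual)
  show "{} \<in> indeps (dual_matroid M)"
    using ex_basis_above[OF empty_indep] by (auto simp: indeps_dual)
  show "J \<in> indeps (dual_matroid M)" if "I \<in> indeps (dual_matroid M)" "J \<subseteq> I" for I J
    using that by (auto simp: indeps_dual)
  fix I J assume I: "I \<in> indeps (dual_matroid M)" and J: "J \<in> indeps (dual_matroid M)"
    and less: "card I < card J"
  have fin: "finite I" "finite J" using I J finite_ground finite_subset by (auto simp: indeps_dual)
  obtain B C where B: "B \<in> bases M" "J \<inter> B = {}" and C: "C \<in> bases M" "I \<inter> C = {}"
    using I J by (auto simp: indeps_dual)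
  have "B - I \<in> indeps M" using bases_indep[OF B(1)] indep_subset by blast
  then obtain B' where B': "B' \<in> bases M" "B - I \<subseteq> B'" "B' \<subseteq> (B - I) \<union> C"
    using ex_basis_between C(1) by blast
  have "\<not> J - I \<subseteq> B'"
  proof
    assume sub: "J - I \<subseteq> B'"
    have finB: "finite B" "finite B'" using B(1) B'(1) bases_indep finite_indep by blast+
    have "card (B - I) + card (J - I) = card ((B - I) \<union> (J - I))"
      using B(2) finB fin by (intro card_Un_disjoint[symmetric]) auto
    also have "\<dots> \<le> card B'" using sub B'(2) finB by (intro card_mono) auto
    also have "\<dots> = card B" using bases_card B B' by blast
    also have "\<dots> = card (B - I) + card (B \<inter> I)"
      using finB by (metis add.commute card_Int_Diff)
    also have "card (B \<inter> I) \<le> card (I - J)" using B(2) fin by (intro card_mono) auto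
    finally have "card (J - I) \<le> card (I - J)" by simp
    then show False using less fin card_Int_Diff[of I J] card_Int_Diff[of J I] by (simp add: Int_commute)
  qed
  then obtain x where x: "x \<in> J - I" "x \<notin> B'" by blast
  moreover have "insert x I \<inter> B' = {}" using x B'(3) C(2) by blast
  ultimately show "\<exists>x \<in> J - I. insert x I \<in> indeps (dual_matroid M)"
    using B'(1) I J by (intro bexI[of _ x]) (auto simp: indeps_dual)
qed

lemma bases_dual: "B \<in> bases (dual_matroid M) \<longleftrightarrow> B \<subseteq> ground M \<and> ground M - B \<in> bases M"
proof
  assume B: "B \<in> bases (dual_matroid M)"
  then obtain C where C: "C \<in> bases M" "B \<inter> C = {}" and sub: "B \<subseteq> ground M"
    using bases_indep[OF B] by (auto simp: indeps_dual)
  have "C \<subseteq> ground M" using C bases_indep indeps_ground by blast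
  moreover have "ground M - C \<in> indeps (dual_matroid M)" using C by (auto simp: indeps_dual)
  ultimately have "ground M - C = B" using bases_maximal[OF B] C(2) sub by blast
  then have "ground M - B = C" using \<open>C \<subseteq> ground M\<close> by blast
  then show "B \<subseteq> ground M \<and> ground M - B \<in> bases M" using sub C by simp
next
  assume B: "B \<subseteq> ground M \<and> ground M - B \<in> bases M"
  then have "B \<in> indeps (dual_matroid M)" by (auto simp: indeps_dual)
  moreover have "I = B" if "I \<in> indeps (dual_matroid M)" "B \<subseteq> I" for I
  proof -
    obtain C where C: "C \<in> bases M" "I \<inter> C = {}" "I \<subseteq> ground M"
      using \<open>I \<in> indeps (dual_matroid M)\<close> by (auto simp: indeps_dual)
    then have "C \<subseteq> ground M - I" using bases_indep indeps_ground by blast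
    then have "ground M - B = C"
      using bases_maximal[OF C(1)] bases_indep B that(2) by blast
    then show ?thesis using C that B by blast
  qed
  ultimately show "B \<in> bases (dual_matroid M)" unfolding bases_def by blast
qed

lemma dual_dual: "dual_matroid (dual_matroid M) = M"
proof (rule indep_system_eqI)
  fix I
  show "I \<in> indeps (dual_matroid (dual_matroid M)) \<longleftrightarrow> I \<in> indeps M"
  proof
    assume "I \<in> indeps (dual_matroid (dual_matroid M))"
    then obtain B where "I \<subseteq> ground M" "ground M - B \<in> bases M" "I \<inter> B = {}"
      by (auto simp: indeps_dual[of _ "dual_matroid M"] bases_dual)
    then show "I \<in> indeps M" using bases_indep indep_subset[of "ground M - B" I] by blast
  next
    assume I: "I \<in> indeps M"
    then obtain B where B: "B \<in> bases M" "I \<subseteq> B" using ex_basis_above by blast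
    have sub: "B \<subseteq> ground M" using B bases_indep indeps_ground by blast
    then have "ground M - (ground M - B) \<in> bases M" using B by (simp add: double_diff)
    then have "ground M - B \<in> bases (dual_matroid M)" by (simp add: bases_dual)
    then show "I \<in> indeps (dual_matroid (dual_matroid M))"
      using B sub by (auto simp: indeps_dual[of _ "dual_matroid M"] intro!: bexI[of _ "ground M - B"])
  qed
qed simp

lemma matroid_contraction:
  assumes "Y \<subseteq> ground M"
  shows "matroid (contraction M Y)"
proof -
  interpret D: matroid "dual_matroid M" by (rule matroid_dual)
  have "matroid (restriction (dual_matroid M) Y)" using assms by (intro D.matroid_restriction) simp
  then show ?thesis unfolding contraction_def by (rule matroid.matroid_dual)
qed

text \<open>The usual description of contraction inside the matroid. It makes the interplay with
  restriction computable, which the definition through two duals hides.\<close>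

lemma indeps_contraction:
  assumes Y: "Y \<subseteq> ground M"
  shows "I \<in> indeps (contraction M Y) \<longleftrightarrow>
    I \<subseteq> Y \<and> (\<exists>K \<in> bases (restriction M (ground M - Y)). I \<union> K \<in> indeps M)"
proof
  interpret R: matroid "restriction M (ground M - Y)" by (rule matroid_restriction) blast
  show "I \<subseteq> Y \<and> (\<exists>K \<in> bases (restriction M (ground M - Y)). I \<union> K \<in> indeps M)"
    if "I \<in> indeps (contraction M Y)"
  proof -
    obtain B where B: "B \<in> bases (restriction (dual_matroid M) Y)" and I: "I \<subseteq> Y" "I \<inter> B = {}"
      using \<open>I \<in> indeps (contraction M Y)\<close> unfolding contraction_def
      by (auto simp: indeps_dual[of _ "restriction (dual_matroid M) Y"])
    then obtain C where C: "C \<in> bases M" "B \<inter> C = {}" and BY: "B \<subseteq> Y"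
      using bases_indep[OF B] by (auto simp: indeps_dual)
    \<comment> \<open>By maximality of \<open>B\<close>, every basis avoiding \<open>B\<close> has
      the same trace on \<open>Y\<close>.\<close>
    have max: "Y - C' = B" if "C' \<in> bases M" "B \<inter> C' = {}" for C'
    proof (rule bases_maximal[OF B])
      show "Y - C' \<in> indeps (restriction (dual_matroid M) Y)"
        using that Y by (auto simp: indeps_dual)
    qed (use BY that in blast)
    \<comment> \<open>A larger independent set \<open>K\<close> outside \<open>Y\<close> extends,
      using elements of \<open>C\<close> only, to a basis that still avoids \<open>B\<close>. Having
      the trace of \<open>C\<close> on \<open>Y\<close>, it contains \<open>C\<close> and so equals
      it.\<close>
    have "C - Y \<in> bases (restriction M (ground M - Y))"
      unfolding bases_def
    proof (intro CollectI conjI ballI impI)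
      show "C - Y \<in> indeps (restriction M (ground M - Y))"
        using bases_indep[OF C(1)] indeps_ground indep_subset[of C] by auto
      fix K assume K: "K \<in> indeps (restriction M (ground M - Y))" "C - Y \<subseteq> K"
      then obtain C' where C': "C' \<in> bases M" "K \<subseteq> C'" "C' \<subseteq> K \<union> C"
        using ex_basis_between[of K C] C(1) by auto
      have "B \<inter> C' = {}" using C'(3) C(2) K(1) BY by auto
      then have "Y - C' = Y - C" using max C' C by metis
      then have "C \<subseteq> C'" using K(2) C'(2) by blast
      then have "C' = C" using bases_maximal[OF C(1)] bases_indep[OF C'(1)] by blast
      then show "K = C - Y" using K C'(2) by auto
    qed
    moreover have "I \<union> (C - Y) \<subseteq> C" using max[OF C] I by blast
    then have "I \<union> (C - Y) \<in> indeps M" using bases_indep[OF C(1)] indep_subset by blast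
    ultimately show ?thesis using I by blast
  qed
  show "I \<in> indeps (contraction M Y)"
    if *: "I \<subseteq> Y \<and> (\<exists>K \<in> bases (restriction M (ground M - Y)). I \<union> K \<in> indeps M)"
  proof -
    obtain K where K: "K \<in> bases (restriction M (ground M - Y))" "I \<union> K \<in> indeps M" and I: "I \<subseteq> Y"
      using * by blast
    obtain C where C: "C \<in> bases M" "I \<union> K \<subseteq> C" using ex_basis_above K(2) by blast
    have rest: "C' - Y \<in> indeps (restriction M (ground M - Y))" if "C' \<in> bases M" for C'
      using bases_indep[OF that] indeps_ground indep_subset[of C'] by auto
    have CK: "C - Y = K"
      using bases_maximal[OF K(1) rest[OF C(1)]] C(2) bases_indep[OF K(1)] by auto
    have "Y - C \<in> bases (restriction (dual_matroid M) Y)"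
      unfolding bases_def
    proof (intro CollectI conjI ballI impI)
      show "Y - C \<in> indeps (restriction (dual_matroid M) Y)"
        using C Y by (auto simp: indeps_dual)
      fix J assume J: "J \<in> indeps (restriction (dual_matroid M) Y)" "Y - C \<subseteq> J"
      then obtain C' where C': "C' \<in> bases M" "J \<inter> C' = {}" and JY: "J \<subseteq> Y"
        by (auto simp: indeps_dual)
      have fin: "finite C" "finite C'" using C C' bases_indep finite_indep by auto
      \<comment> \<open>\<open>C\<close> is as large as possible outside \<open>Y\<close>, so no
        basis has fewer elements inside \<open>Y\<close>. As \<open>J\<close> contains
        \<open>Y - C\<close> and avoids \<open>C'\<close>, the traces of \<open>C'\<close> and
        \<open>C\<close> on \<open>Y\<close> must coincide.\<close>
      have "card (C' - Y) \<le> card (C - Y)"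
        using R.bases_iff_card K(1) rest[OF C'(1)] CK by blast
      moreover have "card (C' \<inter> Y) + card (C' - Y) = card (C \<inter> Y) + card (C - Y)"
        using bases_card[OF C(1) C'(1)] card_Int_Diff[OF fin(1), of Y] card_Int_Diff[OF fin(2), of Y]
        by linarith
      ultimately have "card (C \<inter> Y) \<le> card (C' \<inter> Y)" by linarith
      moreover have "C' \<inter> Y \<subseteq> C \<inter> Y" using C'(2) J(2) by blast
      ultimately have "C' \<inter> Y = C \<inter> Y" using fin by (intro card_seteq) auto
      then show "J = Y - C" using C'(2) J JY by blast
    qed
    then show ?thesis
      unfolding contraction_def indeps_dual using I C(2) by (auto intro!: bexI[of _ "Y - C"])
  qed
qed

text \<open>The two inner duals cancel, leaving two successive restrictions of the dual.\<close>

lemma contraction_contraction: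
  assumes "Z \<subseteq> Y" "Y \<subseteq> ground M"
  shows "contraction (contraction M Y) Z = contraction M Z"
proof -
  interpret D: matroid "dual_matroid M" by (rule matroid_dual)
  have "matroid (restriction (dual_matroid M) Y)" using assms by (intro D.matroid_restriction) simp
  then show ?thesis
    unfolding contraction_def by (simp add: matroid.dual_dual restriction_restriction assms)
qed

text \<open>Both sides contract \<open>X - Y\<close> and delete \<open>ground M - X\<close>; on the
  right the elements to be deleted are carried along during the contraction.\<close>

lemma contraction_restriction:
  assumes "Y \<subseteq> X" "X \<subseteq> ground M"
  shows "contraction (restriction M X) Y = restriction (contraction M (Y \<union> (ground M - X))) Y"
proof (rule indep_system_eqI)
  interpret R: matroid "restriction M X" using assms by (intro matroid_restriction)
  have "ground M - (Y \<union> (ground M - X)) = X - Y" using assms by blast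
  then show "I \<in> indeps (contraction (restriction M X) Y) \<longleftrightarrow>
    I \<in> indeps (restriction (contraction M (Y \<union> (ground M - X))) Y)" for I
    using assms bases_indep[of _ "restriction M (X - Y)"]
    by (auto simp: R.indeps_contraction indeps_contraction restriction_restriction) blast
qed simp

text \<open>The second contraction is moved past the first restriction and merged with the first
  contraction; the restrictions then merge as well.\<close>

lemma minors_minors:
  assumes "N \<in> minors M"
  shows "minors N \<subseteq> minors M"
proof
  fix L assume "L \<in> minors N"
  obtain X Y where XY: "X \<subseteq> Y" "Y \<subseteq> ground M" "N = restriction (contraction M Y) X"
    using assms unfolding minors_def by blast
  obtain X' Y' where XY': "X' \<subseteq> Y'" "Y' \<subseteq> X" "L = restriction (contraction N Y') X'"
    using \<open>L \<in> minors N\<close> XY(3) unfolding minors_def by auto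
  interpret C: matroid "contraction M Y" using XY by (intro matroid_contraction)
  have "contraction N Y' = restriction (contraction (contraction M Y) (Y' \<union> (Y - X))) Y'"
    using C.contraction_restriction[of Y' X] XY XY' by simp
  also have "contraction (contraction M Y) (Y' \<union> (Y - X)) = contraction M (Y' \<union> (Y - X))"
    using XY XY' by (intro contraction_contraction) auto
  finally have "L = restriction (contraction M (Y' \<union> (Y - X))) X'"
    using XY' by (simp add: restriction_restriction)
  then show "L \<in> minors M"
    unfolding minors_def using XY XY' by blast
qed

lemma matroid_minor:
  assumes "N \<in> minors M"
  shows "matroid N"
proof -
  obtain X Y where "X \<subseteq> Y" "Y \<subseteq> ground M" "N = restriction (contraction M Y) X"
    using assms unfolding minors_def by blast
  then show ?thesis using matroid.matroid_restriction[OF matroid_contraction] by simp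
qed

text \<open>Contracting the dual to \<open>Y\<close> gives the dual of
  \<open>restriction M Y\<close>, so the dual of \<open>N\<close> is a contraction of that
  restriction.\<close>

lemma dual_minor_of_dual:
  assumes "N \<in> minors (dual_matroid M)"
  shows "dual_matroid N \<in> minors M"
proof -
  obtain X Y where XY: "X \<subseteq> Y" "Y \<subseteq> ground M" "N = restriction (contraction (dual_matroid M) Y) X"
    using assms unfolding minors_def by auto
  have "dual_matroid N = contraction (restriction M Y) X"
    unfolding XY(3) contraction_def dual_dual ..
  also have "\<dots> = restriction (contraction M (X \<union> (ground M - Y))) X"
    using XY by (intro contraction_restriction)
  finally show ?thesis using XY unfolding minors_def by blast
qed

end

section \<open>Direct sums over disjoint ground sets\<close>

locale disjoint_matroids = M: matroid M + N: matroid N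
  for M N :: "'a indep_system" +
  assumes disjoint_ground: "ground M \<inter> ground N = {}"
begin

lemma indeps_direct_sum:
  "I \<in> indeps (direct_sum M N) \<longleftrightarrow>
    I \<subseteq> ground M \<union> ground N \<and> I \<inter> ground M \<in> indeps M \<and> I \<inter> ground N \<in> indeps N"
proof
  assume "I \<in> indeps (direct_sum M N)"
  then obtain J K where "I = J \<union> K" "J \<in> indeps M" "K \<in> indeps N" by (auto simp: direct_sum_def)
  moreover from this have "J \<subseteq> ground M" "K \<subseteq> ground N"
    using M.indeps_ground N.indeps_ground by auto
  moreover from this have "(J \<union> K) \<inter> ground M = J" "(J \<union> K) \<inter> ground N = K"
    using disjoint_ground by blast+
  ultimately show "I \<subseteq> ground M \<union> ground N \<and> I \<inter> ground M \<in> indeps M \<and> I \<inter> ground N \<in> indeps N"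
    by auto
next
  assume I: "I \<subseteq> ground M \<union> ground N \<and> I \<inter> ground M \<in> indeps M \<and> I \<inter> ground N \<in> indeps N"
  then have "I = (I \<inter> ground M) \<union> (I \<inter> ground N)" by blast
  then show "I \<in> indeps (direct_sum M N)" unfolding direct_sum_def using I by auto
qed

text \<open>The larger of two independent sets is larger on one of the summands, and augmentation is
  done there.\<close>

lemma matroid_direct_sum: "matroid (direct_sum M N)"
proof
  show "finite (ground (direct_sum M N))" using M.finite_ground N.finite_ground by simp
  show "{} \<in> indeps (direct_sum M N)"
    using M.empty_indep N.empty_indep by (simp add: indeps_direct_sum)
  show "I \<subseteq> ground (direct_sum M N)" if "I \<in> indeps (direct_sum M N)" for I
    using that by (simp add: indeps_direct_sum)
  show "J \<in> indeps (direct_sum M N)" if "I \<in> indeps (direct_sum M N)" "J \<subseteq> I" for I J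
    using that M.indep_subset[of "I \<inter> ground M" "J \<inter> ground M"]
      N.indep_subset[of "I \<inter> ground N" "J \<inter> ground N"]
    unfolding indeps_direct_sum by blast
  fix I J assume IJ: "I \<in> indeps (direct_sum M N)" "J \<in> indeps (direct_sum M N)" "card I < card J"
  have split: "card K = card (K \<inter> ground M) + card (K \<inter> ground N)"
    if "K \<in> indeps (direct_sum M N)" for K
  proof -
    have "K = (K \<inter> ground M) \<union> (K \<inter> ground N)" using that by (auto simp: indeps_direct_sum)
    then show ?thesis
      using card_Un_disjoint[of "K \<inter> ground M" "K \<inter> ground N"] M.finite_ground N.finite_ground
        disjoint_ground by (metis (no_types, lifting) finite_Int inf_assoc inf_bot_right inf_commute)
  qed
  consider "card (I \<inter> ground M) < card (J \<inter> ground M)" | "card (I \<inter> ground N) < card (J \<inter> ground N)"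
    using IJ split[of I] split[of J] by linarith
  then show "\<exists>x \<in> J - I. insert x I \<in> indeps (direct_sum M N)"
  proof cases
    case 1
    then obtain x where x: "x \<in> J \<inter> ground M - I \<inter> ground M" "insert x (I \<inter> ground M) \<in> indeps M"
      using M.augment IJ unfolding indeps_direct_sum by blast
    then have "insert x I \<inter> ground M = insert x (I \<inter> ground M)" "insert x I \<inter> ground N = I \<inter> ground N"
      using disjoint_ground by blast+
    then show ?thesis using x IJ by (intro bexI[of _ x]) (auto simp: indeps_direct_sum)
  next
    case 2
    then obtain x where x: "x \<in> J \<inter> ground N - I \<inter> ground N" "insert x (I \<inter> ground N) \<in> indeps N"
      using N.augment IJ unfolding indeps_direct_sum by blast
    then have "insert x I \<inter> ground N = insert x (I \<inter> ground N)" "insert x I \<inter> ground M = I \<inter> ground M"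
      using disjoint_ground by blast+
    then show ?thesis using x IJ by (intro bexI[of _ x]) (auto simp: indeps_direct_sum)
  qed
qed

lemma bases_direct_sum:
  "B \<in> bases (direct_sum M N) \<longleftrightarrow>
    B \<subseteq> ground M \<union> ground N \<and> B \<inter> ground M \<in> bases M \<and> B \<inter> ground N \<in> bases N"
proof
  assume B: "B \<in> bases (direct_sum M N)"
  note ind = bases_indep[OF B, unfolded indeps_direct_sum]
  have "B \<inter> ground M \<in> bases M"
    unfolding bases_def
  proof (intro CollectI conjI ballI impI)
    fix I assume I: "I \<in> indeps M" "B \<inter> ground M \<subseteq> I"
    have eq: "(I \<union> B \<inter> ground N) \<inter> ground M = I" "(I \<union> B \<inter> ground N) \<inter> ground N = B \<inter> ground N"
      using M.indeps_ground[OF I(1)] disjoint_ground by blast+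
    have "I \<union> B \<inter> ground N \<in> indeps (direct_sum M N)"
      unfolding indeps_direct_sum eq using ind I(1) M.indeps_ground[OF I(1)] by blast
    then have "I \<union> B \<inter> ground N = B" using bases_maximal[OF B] I(2) ind by blast
    then show "I = B \<inter> ground M" using eq(1) by simp
  qed (use ind in blast)
  moreover have "B \<inter> ground N \<in> bases N"
    unfolding bases_def
  proof (intro CollectI conjI ballI impI)
    fix I assume I: "I \<in> indeps N" "B \<inter> ground N \<subseteq> I"
    have eq: "(I \<union> B \<inter> ground M) \<inter> ground N = I" "(I \<union> B \<inter> ground M) \<inter> ground M = B \<inter> ground M"
      using N.indeps_ground[OF I(1)] disjoint_ground by blast+
    have "I \<union> B \<inter> ground M \<in> indeps (direct_sum M N)"
      unfolding indeps_direct_sum eq using ind I(1) N.indeps_ground[OF I(1)] by blast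
    then have "I \<union> B \<inter> ground M = B" using bases_maximal[OF B] I(2) ind by blast
    then show "I = B \<inter> ground N" using eq(1) by simp
  qed (use ind in blast)
  ultimately show "B \<subseteq> ground M \<union> ground N \<and> B \<inter> ground M \<in> bases M \<and> B \<inter> ground N \<in> bases N"
    using ind by blast
next
  assume B: "B \<subseteq> ground M \<union> ground N \<and> B \<inter> ground M \<in> bases M \<and> B \<inter> ground N \<in> bases N"
  show "B \<in> bases (direct_sum M N)"
    unfolding bases_def
  proof (intro CollectI conjI ballI impI)
    show "B \<in> indeps (direct_sum M N)" using B bases_indep by (auto simp: indeps_direct_sum)
    fix I assume I: "I \<in> indeps (direct_sum M N)" "B \<subseteq> I"
    then have "I \<inter> ground M = B \<inter> ground M" "I \<inter> ground N = B \<inter> ground N"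
      by (auto intro!: bases_maximal B[THEN conjunct2, THEN conjunct1] B[THEN conjunct2, THEN conjunct2]
        simp: indeps_direct_sum del: equalityI)
    then show "I = B" using I B unfolding indeps_direct_sum by blast
  qed
qed

lemma restriction_direct_sum:
  assumes "X \<subseteq> ground M \<union> ground N"
  shows "restriction (direct_sum M N) X =
    direct_sum (restriction M (X \<inter> ground M)) (restriction N (X \<inter> ground N))"
proof (rule indep_system_eqI)
  interpret R: disjoint_matroids "restriction M (X \<inter> ground M)" "restriction N (X \<inter> ground N)"
    using M.matroid_restriction N.matroid_restriction disjoint_ground
    by (auto simp: disjoint_matroids_def disjoint_matroids_axioms_def)
  fix I
  show "I \<in> indeps (restriction (direct_sum M N) X) \<longleftrightarrow>
    I \<in> indeps (direct_sum (restriction M (X \<inter> ground M)) (restriction N (X \<inter> ground N)))"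
  proof (cases "I \<subseteq> X")
    case True
    then have "I \<inter> (X \<inter> ground M) = I \<inter> ground M" "I \<inter> (X \<inter> ground N) = I \<inter> ground N"
      by blast+
    then show ?thesis using True by (auto simp: indeps_direct_sum R.indeps_direct_sum)
  qed (auto simp: R.indeps_direct_sum)
qed (use assms in auto)

lemma disjoint_duals: "disjoint_matroids (dual_matroid M) (dual_matroid N)"
  using M.matroid_dual N.matroid_dual disjoint_ground
  by (simp add: disjoint_matroids_def disjoint_matroids_axioms_def)

lemma dual_direct_sum:
  "dual_matroid (direct_sum M N) = direct_sum (dual_matroid M) (dual_matroid N)"
proof (rule indep_system_eqI)
  interpret D: disjoint_matroids "dual_matroid M" "dual_matroid N" by (rule disjoint_duals)
  fix I
  show "I \<in> indeps (dual_matroid (direct_sum M N)) \<longleftrightarrow>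
    I \<in> indeps (direct_sum (dual_matroid M) (dual_matroid N))"
  proof
    assume "I \<in> indeps (dual_matroid (direct_sum M N))"
    then obtain B where "I \<subseteq> ground M \<union> ground N" "B \<inter> ground M \<in> bases M" "B \<inter> ground N \<in> bases N"
      "I \<inter> B = {}"
      by (auto simp: indeps_dual bases_direct_sum)
    then show "I \<in> indeps (direct_sum (dual_matroid M) (dual_matroid N))"
      unfolding D.indeps_direct_sum indeps_dual
      by (intro conjI bexI[of _ "B \<inter> ground M"] bexI[of _ "B \<inter> ground N"]) auto
  next
    assume "I \<in> indeps (direct_sum (dual_matroid M) (dual_matroid N))"
    then obtain B C where I: "I \<subseteq> ground M \<union> ground N"
      and B: "B \<in> bases M" "I \<inter> ground M \<inter> B = {}" and C: "C \<in> bases N" "I \<inter> ground N \<inter> C = {}"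
      unfolding D.indeps_direct_sum indeps_dual by auto
    have sub: "B \<subseteq> ground M" "C \<subseteq> ground N"
      using B C bases_indep M.indeps_ground N.indeps_ground by blast+
    then have "(B \<union> C) \<inter> ground M = B" "(B \<union> C) \<inter> ground N = C" using disjoint_ground by blast+
    then have "B \<union> C \<in> bases (direct_sum M N)" using B C sub by (auto simp: bases_direct_sum)
    moreover have "I \<inter> (B \<union> C) = {}" using B C sub by blast
    ultimately show "I \<in> indeps (dual_matroid (direct_sum M N))"
      using I by (auto simp: indeps_dual)
  qed
qed simp

lemma contraction_direct_sum:
  assumes "Y \<subseteq> ground M \<union> ground N"
  shows "contraction (direct_sum M N) Y =
    direct_sum (contraction M (Y \<inter> ground M)) (contraction N (Y \<inter> ground N))"
proof -
  interpret D: disjoint_matroids "dual_matroid M" "dual_matroid N" by (rule disjoint_duals)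
  interpret R: disjoint_matroids "restriction (dual_matroid M) (Y \<inter> ground M)"
      "restriction (dual_matroid N) (Y \<inter> ground N)"
    using D.M.matroid_restriction[of "Y \<inter> ground M"] D.N.matroid_restriction[of "Y \<inter> ground N"]
      disjoint_ground
    by (auto simp: disjoint_matroids_def disjoint_matroids_axioms_def)
  show ?thesis
    unfolding contraction_def dual_direct_sum
    using assms by (simp add: D.restriction_direct_sum R.dual_direct_sum)
qed

lemma minor_direct_sum:
  assumes "L \<in> minors (direct_sum M N)"
  obtains L1 L2 where "L1 \<in> minors M" "L2 \<in> minors N" "L = direct_sum L1 L2"
    "ground L1 \<inter> ground L2 = {}"
proof -
  obtain X Y where XY: "X \<subseteq> Y" "Y \<subseteq> ground M \<union> ground N"
    "L = restriction (contraction (direct_sum M N) Y) X"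
    using assms unfolding minors_def by auto
  interpret C: disjoint_matroids "contraction M (Y \<inter> ground M)" "contraction N (Y \<inter> ground N)"
    using M.matroid_contraction N.matroid_contraction disjoint_ground
    by (auto simp: disjoint_matroids_def disjoint_matroids_axioms_def)
  \<comment> \<open>The inner sets \<open>Y \<inter> ground M\<close> and
    \<open>Y \<inter> ground N\<close> are the ground sets of the contractions, so each summand has
    the literal form of a minor.\<close>
  have "L = direct_sum (restriction (contraction M (Y \<inter> ground M)) (X \<inter> (Y \<inter> ground M)))
    (restriction (contraction N (Y \<inter> ground N)) (X \<inter> (Y \<inter> ground N)))"
    unfolding XY(3) contraction_direct_sum[OF XY(2)]
  proof -
    have "X \<subseteq> Y \<inter> ground M \<union> Y \<inter> ground N" using XY by blast
    then show "restriction (direct_sum (contraction M (Y \<inter> ground M)) (contraction N (Y \<inter> ground N))) X =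
      direct_sum (restriction (contraction M (Y \<inter> ground M)) (X \<inter> (Y \<inter> ground M)))
        (restriction (contraction N (Y \<inter> ground N)) (X \<inter> (Y \<inter> ground N)))"
      using C.restriction_direct_sum[of X] by simp
  qed
  moreover have "restriction (contraction M (Y \<inter> ground M)) (X \<inter> (Y \<inter> ground M)) \<in> minors M"
    "restriction (contraction N (Y \<inter> ground N)) (X \<inter> (Y \<inter> ground N)) \<in> minors N"
    unfolding minors_def by blast+
  ultimately show ?thesis using that disjoint_ground by fastforce
qed

end

section \<open>Duality and direct sums of standard representations\<close>

text \<open>An injection of \<open>V - T\<close> into \<open>V\<close> misses exactly
  \<open>card T\<close> vertices, among them \<open>X\<close>. The only difficulty is to have all of
  them in \<open>E\<close>.\<close>

lemma linked_extend:
  assumes std: "std_digraph V A T E" and lk: "linked V A T X" and X: "X \<subseteq> E"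
  obtains Y where "X \<subseteq> Y" "Y \<subseteq> E" "linked V A T Y" "card Y = card T"
proof -
  define L where "L \<phi> \<longleftrightarrow> inj_on \<phi> (V - T) \<and> \<phi> ` (V - T) \<subseteq> V - X \<and>
    (\<forall>v \<in> V - T. \<phi> v = v \<or> (v, \<phi> v) \<in> A)" for \<phi>
  have V: "finite V" "T \<subseteq> E" "E \<subseteq> V" using std by (auto simp: std_digraph_def)
  let ?moved = "\<lambda>\<phi>. {v \<in> V - T. \<phi> v \<noteq> v}"
  \<comment> \<open>If \<open>\<phi>\<close> moves as few vertices as possible, then every vertex it misses lies in \<open>E\<close>.\<close>
  obtain \<phi> where L: "L \<phi>" and min: "\<And>\<psi>. L \<psi> \<Longrightarrow> card (?moved \<phi>) \<le> card (?moved \<psi>)"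
  proof -
    obtain \<phi>\<^sub>0 where "L \<phi>\<^sub>0" using lk unfolding linked_def L_def by blast
    from ex_has_least_nat[of L, OF this, of "\<lambda>\<phi>. card (?moved \<phi>)"] show ?thesis using that by blast
  qed
  define Y where "Y = V - \<phi> ` (V - T)"
  have "Y \<subseteq> E"
  proof (rule ccontr)
    assume "\<not> Y \<subseteq> E"
    then obtain v where v: "v \<in> V - T" "v \<notin> \<phi> ` (V - T)" "v \<notin> E" using V unfolding Y_def by blast
    \<comment> \<open>As \<open>v\<close> is missed, letting it stay keeps injectivity; as it is
      outside \<open>E\<close>, it is not in \<open>X\<close>. It was moved before, so this lowers
      the number of moved vertices.\<close>
    have "L (\<phi>(v := v))"
      unfolding L_def
    proof (intro conjI ballI)
      show "inj_on (\<phi>(v := v)) (V - T)" using L v by (auto simp: L_def intro: inj_on_fun_updI)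
      show "(\<phi>(v := v)) ` (V - T) \<subseteq> V - X" using L v X by (auto simp: L_def)
      show "(\<phi>(v := v)) u = u \<or> (u, (\<phi>(v := v)) u) \<in> A" if "u \<in> V - T" for u
        using L that by (auto simp: L_def)
    qed
    moreover have "?moved (\<phi>(v := v)) \<subset> ?moved \<phi>" using v by force
    then have "card (?moved (\<phi>(v := v))) < card (?moved \<phi>)"
      using V(1) by (intro psubset_card_mono) auto
    ultimately show False using min by (meson not_le)
  qed
  moreover have "card Y = card T"
  proof -
    have "card (\<phi> ` (V - T)) = card (V - T)" using L by (auto simp: L_def card_image)
    moreover have "\<phi> ` (V - T) \<subseteq> V" using L by (auto simp: L_def)
    ultimately have "card Y = card V - card (V - T)"
      unfolding Y_def using V(1) by (simp add: card_Diff_subset finite_subset)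
    also have "\<dots> = card V - (card V - card T)"
      using V by (subst card_Diff_subset[of T]) (auto intro: finite_subset)
    also have "\<dots> = card T" using card_mono[of V T] V by auto
    finally show ?thesis .
  qed
  moreover have "X \<subseteq> Y" using L X V unfolding L_def Y_def by blast
  moreover have "linked V A T Y"
    using L unfolding L_def linked_def Y_def by blast
  ultimately show ?thesis using that by blast
qed

text \<open>Because \<open>X\<close> has as many elements as \<open>T\<close>, the linking is a
  bijection from \<open>V - T\<close> onto \<open>V - X\<close>. Its inverse runs along reversed
  arcs, and the vertices of \<open>X\<close> in the new domain, all in \<open>T\<close>,
  stay.\<close>

lemma linked_converse:
  assumes std: "std_digraph V A T E" and lk: "linked V A T X" and X: "X \<subseteq> E" "card X = card T"
  shows "linked V (A\<inverse>) (E - T) (E - X)"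
proof -
  have V: "finite V" "T \<subseteq> E" "E \<subseteq> V" and source: "\<And>e u. e \<in> E - T \<Longrightarrow> (u, e) \<notin> A"
    using std by (auto simp: std_digraph_def)
  obtain \<phi> where \<phi>: "inj_on \<phi> (V - T)" "\<phi> ` (V - T) \<subseteq> V - X"
    "\<And>v. v \<in> V - T \<Longrightarrow> \<phi> v = v \<or> (v, \<phi> v) \<in> A"
    using lk unfolding linked_def by blast
  have "T \<subseteq> V" "X \<subseteq> V" using V X by auto
  then have "card (V - X) = card (V - T)"
    using V(1) X(2) by (simp add: card_Diff_subset finite_subset)
  then have onto: "\<phi> ` (V - T) = V - X"
    using \<phi>(1,2) V(1) by (intro card_subset_eq) (auto simp: card_image)
  have "\<forall>v \<in> V - X. \<exists>u \<in> V - T. \<phi> u = v" using onto by (metis imageE)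
  then obtain \<psi> where \<psi>: "\<And>v. v \<in> V - X \<Longrightarrow> \<psi> v \<in> V - T" "\<And>v. v \<in> V - X \<Longrightarrow> \<phi> (\<psi> v) = v"
    by metis
  have dom: "v \<in> T \<or> v \<notin> E" if "v \<in> V - (E - T)" for v using that by blast
  show ?thesis
  proof (rule linkedI[of "\<lambda>v. if v \<in> X then v else \<psi> v"])
    show "inj_on (\<lambda>v. if v \<in> X then v else \<psi> v) (V - (E - T))"
    proof (rule inj_onI)
      fix u v assume uv: "u \<in> V - (E - T)" "v \<in> V - (E - T)"
        "(if u \<in> X then u else \<psi> u) = (if v \<in> X then v else \<psi> v)"
      consider "u \<in> X" "v \<in> X" | "u \<in> X" "v \<notin> X" | "u \<notin> X" "v \<in> X" | "u \<notin> X" "v \<notin> X" by blast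
      then show "u = v"
      proof cases
        case 2
        then have "u = \<psi> v" using uv(3) by simp
        moreover have "u \<in> T" using dom[OF uv(1)] X(1) 2(1) by blast
        moreover have "\<psi> v \<in> V - T" using \<psi>(1) uv(2) 2(2) by blast
        ultimately show ?thesis by blast
      next
        case 3
        then have "v = \<psi> u" using uv(3) by simp
        moreover have "v \<in> T" using dom[OF uv(2)] X(1) 3(2) by blast
        moreover have "\<psi> u \<in> V - T" using \<psi>(1) uv(1) 3(1) by blast
        ultimately show ?thesis by blast
      next
        case 4
        then have "\<psi> u = \<psi> v" using uv by simp
        then show ?thesis using \<psi>(2)[of u] \<psi>(2)[of v] uv(1,2) 4 by (metis DiffD1 DiffI)
      qed (use uv in simp)
    qed
  next
    fix v assume v: "v \<in> V - (E - T)"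
    \<comment> \<open>Otherwise \<open>\<psi> v\<close> is in \<open>E - T\<close>. No arc enters
      this source, so its own preimage under \<phi> is itself and \<open>v = \<psi> v\<close>; but
      \<open>E - T\<close> is outside the new domain.\<close>
    have "\<psi> v \<notin> E - X" if "v \<notin> X"
    proof
      assume u: "\<psi> v \<in> E - X"
      have vX: "v \<in> V - X" using v that by blast
      then have uT: "\<psi> v \<in> E - T" using u \<psi>(1) by blast
      have uX: "\<psi> v \<in> V - X" using u V by blast
      then have "\<psi> (\<psi> v) = \<psi> v"
        using \<phi>(3)[OF \<psi>(1)[OF uX]] \<psi>(2)[OF uX] source[OF uT] by metis
      then have "\<psi> v = v" using \<psi>(2)[OF uX] \<psi>(2)[OF vX] by simp
      then show False using uT v by auto
    qed
    then show "(if v \<in> X then v else \<psi> v) \<in> V - (E - X)" using v \<psi>(1)[of v] by auto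
    show "(if v \<in> X then v else \<psi> v) = v \<or> (v, if v \<in> X then v else \<psi> v) \<in> A\<inverse>"
      using \<phi>(3)[of "\<psi> v"] \<psi>[of v] v by auto
  qed
qed

text \<open>The rank is \<open>card T\<close>: linked sets are no larger, and each extends within
  \<open>E\<close> to one of that size.\<close>

lemma bases_linkage_system:
  assumes std: "std_digraph V A T E"
  shows "B \<in> bases (linkage_system V A T E) \<longleftrightarrow> B \<subseteq> E \<and> linked V A T B \<and> card B = card T"
proof
  assume B: "B \<in> bases (linkage_system V A T E)"
  then have lk: "linked V A T B" "B \<subseteq> E" using bases_indep by fastforce+
  then obtain Y where "B \<subseteq> Y" "Y \<subseteq> E" "linked V A T Y" "card Y = card T"
    using linked_extend[OF std] by blast
  then show "B \<subseteq> E \<and> linked V A T B \<and> card B = card T"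
    using bases_maximal[OF B, of Y] lk by auto
next
  assume B: "B \<subseteq> E \<and> linked V A T B \<and> card B = card T"
  have V: "finite V" "T \<subseteq> V" "E \<subseteq> V" using std by (auto simp: std_digraph_def)
  have "I = B" if "I \<subseteq> E" "linked V A T I" "B \<subseteq> I" for I
  proof -
    have "card I \<le> card T" using linked_card_le[OF that(2)] V that by blast
    then show ?thesis using card_seteq[of I B] B that V finite_subset by metis
  qed
  then show "B \<in> bases (linkage_system V A T E)" using B unfolding bases_def by auto
qed

lemma std_digraph_converse:
  "std_digraph V A T E \<Longrightarrow> std_digraph V (A\<inverse>) (E - T) E"
  unfolding std_digraph_def by auto

text \<open>Complements of bases correspond by \<open>linked_converse\<close>. The reversed digraph
  is again of standard form, so the same lemma, after extending \<open>Z\<close> to full size, also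
  gives the other inclusion.\<close>

lemma dual_linkage_system:
  assumes std: "std_digraph V A T E"
  shows "dual_matroid (linkage_system V A T E) = linkage_system V (A\<inverse>) (E - T) E"
proof (rule indep_system_eqI)
  have V: "finite E" "T \<subseteq> E" using std by (auto simp: std_digraph_def intro: finite_subset)
  fix Z
  show "Z \<in> indeps (dual_matroid (linkage_system V A T E)) \<longleftrightarrow>
    Z \<in> indeps (linkage_system V (A\<inverse>) (E - T) E)"
  proof
    assume "Z \<in> indeps (dual_matroid (linkage_system V A T E))"
    then obtain B where "Z \<subseteq> E" "B \<subseteq> E" "linked V A T B" "card B = card T" "Z \<inter> B = {}"
      by (auto simp: indeps_dual bases_linkage_system[OF std])
    then show "Z \<in> indeps (linkage_system V (A\<inverse>) (E - T) E)"
      using linked_subset[OF linked_converse[OF std], of B Z] by auto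
  next
    assume Z: "Z \<in> indeps (linkage_system V (A\<inverse>) (E - T) E)"
    note std' = std_digraph_converse[OF std]
    obtain Y where Y: "Z \<subseteq> Y" "Y \<subseteq> E" "linked V (A\<inverse>) (E - T) Y" "card Y = card (E - T)"
      using linked_extend[OF std'] Z by auto
    have "linked V A T (E - Y)"
      using linked_converse[OF std' Y(3,2,4)] V by (simp add: double_diff)
    moreover have "card (E - Y) = card T"
    proof -
      have "card (E - Y) = card E - card (E - T)"
        using Y V by (simp add: card_Diff_subset finite_subset)
      also have "\<dots> = card T"
        using V card_mono[OF V] by (simp add: card_Diff_subset finite_subset)
      finally show ?thesis .
    qed
    ultimately have "E - Y \<in> bases (linkage_system V A T E)"
      by (auto simp: bases_linkage_system[OF std])
    then show "Z \<in> indeps (dual_matroid (linkage_system V A T E))"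
      using Z Y(1) by (auto simp: indeps_dual intro!: bexI[of _ "E - Y"])
  qed
qed simp

section \<open>Relabelled copies and disjoint unions\<close>

lemma linked_relabel:
  assumes lk: "linked V A T X" and h: "inj_on h V" and sub: "T \<subseteq> V" "X \<subseteq> V"
  shows "linked (h ` V) (map_prod h h ` A) (h ` T) (h ` X)"
proof -
  obtain \<phi> where \<phi>: "inj_on \<phi> (V - T)" "\<And>v. v \<in> V - T \<Longrightarrow> \<phi> v \<in> V - X"
    "\<And>v. v \<in> V - T \<Longrightarrow> \<phi> v = v \<or> (v, \<phi> v) \<in> A"
    using lk by (auto elim: linkedE)
  have dom: "h ` V - h ` T = h ` (V - T)" "h ` V - h ` X = h ` (V - X)"
    using h sub by (auto simp: inj_on_image_set_diff)
  have inv: "inv_into V h (h v) = v" if "v \<in> V" for v using h that by simp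
  show ?thesis
  proof (rule linkedI[of "\<lambda>w. h (\<phi> (inv_into V h w))"], unfold dom)
    show "inj_on (\<lambda>w. h (\<phi> (inv_into V h w))) (h ` (V - T))"
    proof (rule inj_onI, elim imageE)
      fix u v x y assume *: "h (\<phi> (inv_into V h x)) = h (\<phi> (inv_into V h y))"
        "x = h u" "y = h v" "u \<in> V - T" "v \<in> V - T"
      then have "\<phi> u = \<phi> v" using inj_onD[OF h] \<phi>(2) by (simp add: inv)
      then show "x = y" using inj_onD[OF \<phi>(1)] * by blast
    qed
    fix w assume "w \<in> h ` (V - T)"
    then obtain v where v: "v \<in> V - T" "w = h v" by blast
    then have eq: "h (\<phi> (inv_into V h w)) = h (\<phi> v)" using inv by simp
    show "h (\<phi> (inv_into V h w)) \<in> h ` (V - X)" unfolding eq using \<phi>(2) v by blast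
    show "h (\<phi> (inv_into V h w)) = w \<or> (w, h (\<phi> (inv_into V h w))) \<in> map_prod h h ` A"
      unfolding eq using \<phi>(3)[OF v(1)] v(2) by force
  qed
qed

lemma linked_relabel_iff:
  assumes h: "inj_on h V" and sub: "T \<subseteq> V" "X \<subseteq> V" and A: "A \<subseteq> V \<times> V"
  shows "linked (h ` V) (map_prod h h ` A) (h ` T) (h ` X) \<longleftrightarrow> linked V A T X"
proof
  let ?i = "inv_into V h"
  have i: "?i ` h ` S = S" if "S \<subseteq> V" for S using h that by (rule inv_into_image_cancel)
  have "map_prod ?i ?i ` map_prod h h ` A = A"
    using A h by (force simp: image_iff)
  moreover assume "linked (h ` V) (map_prod h h ` A) (h ` T) (h ` X)"
  then have "linked (?i ` h ` V) (map_prod ?i ?i ` map_prod h h ` A) (?i ` h ` T) (?i ` h ` X)"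
    by (rule linked_relabel) (use h sub in \<open>auto intro: inj_on_inv_into\<close>)
  ultimately show "linked V A T X" using i sub by simp
qed (rule linked_relabel, use assms in auto)

text \<open>Auxiliary vertices of two representations may collide. Renaming only the vertices
  outside \<open>E\<close> separates them without altering the matroid or adding arcs.\<close>

lemma ex_std_digraph_avoiding:
  fixes V :: "'a::infinite set"
  assumes std: "std_digraph V A T E" and F: "finite F" "F \<inter> E = {}"
  obtains V' A' where "std_digraph V' A' T E" "linkage_system V' A' T E = linkage_system V A T E"
    "card A' \<le> card A" "V' \<inter> F = {}"
proof -
  have V: "finite V" "A \<subseteq> V \<times> V" "T \<subseteq> E" "E \<subseteq> V" using std by (auto simp: std_digraph_def)
  obtain h :: "'a \<Rightarrow> 'a" where h: "inj_on h V" "\<And>v. v \<in> E \<Longrightarrow> h v = v" "h ` (V - E) \<inter> F = {}"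
    using ex_relabelling[of V F E] V F by metis
  let ?A = "map_prod h h ` A"
  have img: "h ` S = S" if "S \<subseteq> E" for S using h(2) that by force
  have hE: "u = e" if "u \<in> V" "e \<in> E" "h u = e" for u e
    using inj_onD[OF h(1), of u e] that h(2) V by auto
  have "std_digraph (h ` V) ?A T E"
    unfolding std_digraph_def
  proof (intro conjI ballI allI)
    show "(t, w) \<notin> ?A" if t: "t \<in> T" for t w
    proof
      assume "(t, w) \<in> ?A"
      then obtain u v where "(u, v) \<in> A" "h u = t" by auto
      moreover from this have "u = t" using hE V t by auto
      ultimately show False using std t by (auto simp: std_digraph_def)
    qed
    show "(w, e) \<notin> ?A" if e: "e \<in> E - T" for e w
    proof
      assume "(w, e) \<in> ?A"
      then obtain u v where "(v, u) \<in> A" "h u = e" by auto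
      moreover from this have "u = e" using hE V e by auto
      ultimately show False using std e by (auto simp: std_digraph_def)
    qed
    show "E \<subseteq> h ` V" using img[of E] V by blast
  qed (use V in auto)
  moreover have "linkage_system (h ` V) ?A T E = linkage_system V A T E"
  proof (rule indep_system_eqI)
    fix X
    show "X \<in> indeps (linkage_system (h ` V) ?A T E) \<longleftrightarrow> X \<in> indeps (linkage_system V A T E)"
      using linked_relabel_iff[OF h(1), of T X A] img[of T] img[of X] V by auto
  qed simp
  moreover have "card ?A \<le> card A"
    using V by (meson card_image_le finite_SigmaI finite_subset)
  moreover have "h ` V \<inter> F = {}" using h(2,3) F(2) by fastforce
  ultimately show ?thesis using that by blast
qed

lemma std_digraph_Un:
  assumes "std_digraph V A T E" "std_digraph V' A' T' E'" "V \<inter> V' = {}"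
  shows "std_digraph (V \<union> V') (A \<union> A') (T \<union> T') (E \<union> E')"
  using assms unfolding std_digraph_def by (auto; blast)

text \<open>No arc joins the two parts, so a linking splits into linkings of the parts, and two such
  linkings can be glued.\<close>

lemma linkage_system_Un:
  assumes std: "std_digraph V A T E" "std_digraph V' A' T' E'" and disj: "V \<inter> V' = {}"
  shows "linkage_system (V \<union> V') (A \<union> A') (T \<union> T') (E \<union> E') =
    direct_sum (linkage_system V A T E) (linkage_system V' A' T' E')"
proof (rule indep_system_eqI)
  have V: "A \<subseteq> V \<times> V" "T \<subseteq> V" "E \<subseteq> V" "A' \<subseteq> V' \<times> V'" "T' \<subseteq> V'" "E' \<subseteq> V'"
    using std by (auto simp: std_digraph_def)
  let ?lk = "linked (V \<union> V') (A \<union> A') (T \<union> T')"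
  fix X
  show "X \<in> indeps (linkage_system (V \<union> V') (A \<union> A') (T \<union> T') (E \<union> E')) \<longleftrightarrow>
    X \<in> indeps (direct_sum (linkage_system V A T E) (linkage_system V' A' T' E'))"
  proof
    assume "X \<in> indeps (linkage_system (V \<union> V') (A \<union> A') (T \<union> T') (E \<union> E'))"
    then have X: "X \<subseteq> E \<union> E'" and lk: "?lk X" by auto
    have eqs: "(A \<union> A') \<inter> V \<times> V = A" "(T \<union> T') \<inter> V = T"
        "(A \<union> A') \<inter> V' \<times> V' = A'" "(T \<union> T') \<inter> V' = T'"
      using V disj by auto
    have "linked V ((A \<union> A') \<inter> V \<times> V) ((T \<union> T') \<inter> V) (X \<inter> E)"
      by (subst linked_restrict_verts[of V "V \<union> V'"]) (use V disj linked_subset[OF lk] in auto)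
    moreover have "linked V' ((A \<union> A') \<inter> V' \<times> V') ((T \<union> T') \<inter> V') (X \<inter> E')"
      by (subst linked_restrict_verts[of V' "V \<union> V'"]) (use V disj linked_subset[OF lk] in auto)
    ultimately have "X \<inter> E \<in> indeps (linkage_system V A T E)"
        "X \<inter> E' \<in> indeps (linkage_system V' A' T' E')"
      unfolding eqs by auto
    moreover have "X = (X \<inter> E) \<union> (X \<inter> E')" using X by blast
    ultimately show "X \<in> indeps (direct_sum (linkage_system V A T E) (linkage_system V' A' T' E'))"
      unfolding direct_sum_def by auto
  next
    assume "X \<in> indeps (direct_sum (linkage_system V A T E) (linkage_system V' A' T' E'))"
    then obtain Y Z where X: "X = Y \<union> Z" and Y: "Y \<subseteq> E" "linked V A T Y"
      and Z: "Z \<subseteq> E'" "linked V' A' T' Z"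
      unfolding direct_sum_def by auto
    obtain \<phi> where \<phi>: "inj_on \<phi> (V - T)" "\<And>v. v \<in> V - T \<Longrightarrow> \<phi> v \<in> V - Y"
      "\<And>v. v \<in> V - T \<Longrightarrow> \<phi> v = v \<or> (v, \<phi> v) \<in> A"
      using Y(2) by (auto elim: linkedE)
    obtain \<psi> where \<psi>: "inj_on \<psi> (V' - T')" "\<And>v. v \<in> V' - T' \<Longrightarrow> \<psi> v \<in> V' - Z"
      "\<And>v. v \<in> V' - T' \<Longrightarrow> \<psi> v = v \<or> (v, \<psi> v) \<in> A'"
      using Z(2) by (auto elim: linkedE)
    have "?lk X"
    proof (rule linkedI[of "\<lambda>v. if v \<in> V then \<phi> v else \<psi> v"])
      show "inj_on (\<lambda>v. if v \<in> V then \<phi> v else \<psi> v) (V \<union> V' - (T \<union> T'))"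
      proof (rule inj_onI)
        fix u v assume uv: "u \<in> V \<union> V' - (T \<union> T')" "v \<in> V \<union> V' - (T \<union> T')"
          "(if u \<in> V then \<phi> u else \<psi> u) = (if v \<in> V then \<phi> v else \<psi> v)"
        have in_V: "(if w \<in> V then \<phi> w else \<psi> w) \<in> V \<longleftrightarrow> w \<in> V" if "w \<in> V \<union> V' - (T \<union> T')" for w
          using that \<phi>(2)[of w] \<psi>(2)[of w] disj by auto
        show "u = v"
        proof (cases "u \<in> V")
          case True
          then have "v \<in> V" using uv in_V by metis
          then show ?thesis using True uv inj_onD[OF \<phi>(1), of u v] by auto
        next
          case False
          then have "v \<notin> V" using uv in_V by metis
          then show ?thesis using False uv inj_onD[OF \<psi>(1), of u v] by auto
        qed
      qed
    next
      fix v assume v: "v \<in> V \<union> V' - (T \<union> T')"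
      show "(if v \<in> V then \<phi> v else \<psi> v) \<in> V \<union> V' - X"
      proof (cases "v \<in> V")
        case True
        then have "\<phi> v \<in> V - Y" using \<phi>(2) v by blast
        then show ?thesis using True X Z(1) V disj by auto
      next
        case False
        then have "\<psi> v \<in> V' - Z" using \<psi>(2) v by blast
        then show ?thesis using False X Y(1) V disj by auto
      qed
      show "(if v \<in> V then \<phi> v else \<psi> v) = v \<or> (v, if v \<in> V then \<phi> v else \<psi> v) \<in> A \<union> A'"
        using \<phi>(3)[of v] \<psi>(3)[of v] v by auto
    qed
    then show "X \<in> indeps (linkage_system (V \<union> V') (A \<union> A') (T \<union> T') (E \<union> E'))"
      using X Y Z by auto
  qed
qed simp

section \<open>Arc-complexity and width\<close>

lemma arc_complexity_le:
  fixes V :: "'a::infinite set"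
  assumes "std_digraph V A T E"
  shows "arc_complexity (linkage_system V A T E) \<le> card A"
  unfolding arc_complexity_def
proof (rule Least_le, intro exI conjI)
  let ?D = "\<lparr>pverts = V, parcs = A\<rparr>"
  show "standard_representation ?D T (ground (linkage_system V A T E)) (linkage_system V A T E)"
    using assms by (simp add: standard_representation_iff)
  show "card (parcs ?D) = card A" by simp
qed

lemma gammoid_linkage_system:
  fixes V :: "'a::infinite set"
  assumes "std_digraph V A T E" "matroid (linkage_system V A T E)"
  shows "gammoid (linkage_system V A T E)"
proof -
  have "standard_representation \<lparr>pverts = V, parcs = A\<rparr> T E (linkage_system V A T E)"
    using assms by (simp add: standard_representation_iff)
  then show ?thesis
    using assms unfolding gammoid_def standard_representation_def by auto
qed

text \<open>The minimum is attained, since \<open>ex_std_digraph\<close> turns an arbitrary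
  representation into a standard one.\<close>

lemma gammoid_optimal_std_digraph:
  assumes "gammoid M"
  obtains V A T where "std_digraph V A T (ground M)" "M = linkage_system V A T (ground M)"
    "card A = arc_complexity M"
proof -
  obtain D T where rep: "representation D T (ground M) M"
    using assms unfolding gammoid_def by blast
  then have D: "pair_fin_digraph D" "T \<subseteq> pverts D" "ground M \<subseteq> pverts D"
    and M: "M = linkage_system (pverts D) (parcs D) T (ground M)"
    unfolding representation_def using gammoid_of_linked linkage_system_def by metis+
  interpret pair_fin_digraph D by (rule D(1))
  have "parcs D \<subseteq> pverts D \<times> pverts D" using in_arcsD1 in_arcsD2 by auto
  then obtain V A B where "std_digraph V A B (ground M)" "M = linkage_system V A B (ground M)"
    using ex_std_digraph[OF pair_finite_verts] D M by metis
  then have "standard_representation \<lparr>pverts = V, parcs = A\<rparr> B (ground M) M"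
    by (simp add: standard_representation_iff)
  then have "\<exists>n D T. standard_representation D T (ground M) M \<and> card (parcs D) = n" by blast
  then have "\<exists>D T. standard_representation D T (ground M) M \<and> card (parcs D) = arc_complexity M"
    unfolding arc_complexity_def by (rule LeastI_ex)
  then show ?thesis using that by (auto simp: standard_representation_iff)
qed

lemma gammoid_matroid: "gammoid M \<Longrightarrow> matroid M"
  by (simp add: gammoid_def)

text \<open>An optimal standard digraph is reversed, which keeps the number of arcs. Equality would
  follow by dualising once more.\<close>

lemma gammoid_dual:
  assumes "gammoid M"
  shows "gammoid (dual_matroid M)" and "arc_complexity (dual_matroid M) \<le> arc_complexity M"
proof -
  obtain V A T where std: "std_digraph V A T (ground M)" and M: "M = linkage_system V A T (ground M)"
    and card: "card A = arc_complexity M"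
    using assms by (rule gammoid_optimal_std_digraph)
  have dual: "dual_matroid M = linkage_system V (A\<inverse>) (ground M - T) (ground M)"
    using dual_linkage_system[OF std] M by metis
  show "gammoid (dual_matroid M)"
    unfolding dual
    by (rule gammoid_linkage_system[OF std_digraph_converse[OF std]])
      (use matroid.matroid_dual[OF gammoid_matroid[OF assms]] dual in simp)
  have "arc_complexity (dual_matroid M) \<le> card (A\<inverse>)"
    unfolding dual by (rule arc_complexity_le[OF std_digraph_converse[OF std]])
  then show "arc_complexity (dual_matroid M) \<le> arc_complexity M" using card by simp
qed

text \<open>Digraph and targets are kept. The result need not be standard, since targets may lie
  outside \<open>X\<close>.\<close>

lemma gammoid_restriction:
  assumes "gammoid M" "X \<subseteq> ground M"
  shows "gammoid (restriction M X)"
proof -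
  obtain D T where D: "representation D T (ground M) M" and "matroid M"
    using assms unfolding gammoid_def by blast
  then have "M = gammoid_of D T (ground M)" by (simp add: representation_def)
  then have "indeps M = {I. I \<subseteq> ground M \<and> (\<exists>R. routing D I T R)}"
    by (metis gammoid_of_def indep_system.select_convs(2))
  then have "restriction M X = gammoid_of D T X"
    using assms(2) by (intro indep_system_eqI) (auto simp: gammoid_of_def)
  then have "representation D T X (restriction M X)"
    using D assms(2) by (auto simp: representation_def)
  then show ?thesis
    unfolding gammoid_def using matroid.matroid_restriction[OF \<open>matroid M\<close> assms(2)] by auto
qed

lemma gammoid_minor:
  assumes "gammoid M" "N \<in> minors M"
  shows "gammoid N"
proof -
  obtain X Y where "X \<subseteq> Y" "Y \<subseteq> ground M" "N = restriction (contraction M Y) X"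
    using assms unfolding minors_def by blast
  then show ?thesis
    using assms(1) unfolding contraction_def by (simp add: gammoid_dual gammoid_restriction)
qed

lemma gammoid_direct_sum:
  assumes "gammoid M" "gammoid N" "ground M \<inter> ground N = {}"
  shows "gammoid (direct_sum M N)"
    and "arc_complexity (direct_sum M N) \<le> arc_complexity M + arc_complexity N"
proof -
  interpret disjoint_matroids M N
    using assms(3) gammoid_matroid[OF assms(1)] gammoid_matroid[OF assms(2)]
    by (simp add: disjoint_matroids_def disjoint_matroids_axioms_def)
  obtain V A T where M: "std_digraph V A T (ground M)" "M = linkage_system V A T (ground M)"
    "card A = arc_complexity M"
    using assms(1) by (rule gammoid_optimal_std_digraph)
  \<comment> \<open>The order matters: once \<open>V1\<close> avoids the ground set of
    \<open>N\<close>, the digraph of \<open>N\<close> can be moved off all of \<open>V1\<close>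
    while keeping its ground set.\<close>
  obtain V1 A1 where M1: "std_digraph V1 A1 T (ground M)" "M = linkage_system V1 A1 T (ground M)"
    "card A1 \<le> card A" "V1 \<inter> ground N = {}"
    using ex_std_digraph_avoiding[OF M(1) N.finite_ground] M(2) assms(3) by (metis inf_commute)
  obtain W B S where N: "std_digraph W B S (ground N)" "N = linkage_system W B S (ground N)"
    "card B = arc_complexity N"
    using assms(2) by (rule gammoid_optimal_std_digraph)
  have "finite V1" using M1 by (simp add: std_digraph_def)
  then obtain W1 B1 where N1: "std_digraph W1 B1 S (ground N)" "N = linkage_system W1 B1 S (ground N)"
    "card B1 \<le> card B" "W1 \<inter> V1 = {}"
    using ex_std_digraph_avoiding[OF N(1)] N(2) M1(4) by metis
  have disj: "V1 \<inter> W1 = {}" using N1(4) by blast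
  have sum: "direct_sum M N =
      linkage_system (V1 \<union> W1) (A1 \<union> B1) (T \<union> S) (ground M \<union> ground N)"
    using linkage_system_Un[OF M1(1) N1(1) disj] M1(2) N1(2) by simp
  note std = std_digraph_Un[OF M1(1) N1(1) disj]
  show "gammoid (direct_sum M N)"
    unfolding sum by (rule gammoid_linkage_system[OF std]) (use matroid_direct_sum sum in simp)
  have "arc_complexity (direct_sum M N) \<le> card (A1 \<union> B1)"
    unfolding sum by (rule arc_complexity_le[OF std])
  also have "\<dots> \<le> card A1 + card B1" by (rule card_Un_le)
  finally show "arc_complexity (direct_sum M N) \<le> arc_complexity M + arc_complexity N"
    using M M1 N N1 by linarith
qed

text \<open>The digraph without vertices is a standard representation, so an empty summand of a
  minor contributes neither arcs nor elements.\<close>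

lemma arc_complexity_empty:
  assumes "gammoid M" "ground M = {}"
  shows "arc_complexity M = 0"
proof -
  interpret matroid M using assms(1) by (rule gammoid_matroid)
  have "M = linkage_system {} {} {} {}"
    using assms(2) empty_indep indeps_ground by (intro indep_system_eqI) (auto simp: linked_def)
  then show ?thesis using arc_complexity_le[of "{}" "{}" "{}" "{}"] by (simp add: std_digraph_def)
qed

text \<open>A finite ground set has finitely many minors, so the maximum is a bound for each of
  them, and the positive denominators can be cleared.\<close>

lemma f_width_le_iff:
  fixes M :: "'a::infinite indep_system"
  assumes "gammoid M" and f: "\<And>n. f n \<noteq> 0"
  shows "f_width f M \<le> q \<longleftrightarrow>
    (\<forall>N \<in> minors M. of_nat (arc_complexity N) \<le> q * of_nat (f (card (ground N))))"
proof -
  interpret matroid M using assms(1) by (rule gammoid_matroid)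
  let ?g = "\<lambda>N. of_nat (arc_complexity N) / of_nat (f (card (ground N))) :: rat"
  have "{of_nat (arc_complexity (restriction (contraction M Y) X)) / of_nat (f (card X)) | X Y.
      X \<subseteq> Y \<and> Y \<subseteq> ground M} = ?g ` minors M"
    unfolding minors_def by (auto simp: image_iff) (metis ground_simps(1))+
  then have "f_width f M = Max (?g ` minors M)" by (simp add: f_width_def)
  moreover have "finite (minors M)"
  proof (rule finite_subset)
    show "minors M \<subseteq> (\<lambda>(X, Y). restriction (contraction M Y) X) ` (Pow (ground M) \<times> Pow (ground M))"
    proof
      fix N assume "N \<in> minors M"
      then obtain X Y where "X \<subseteq> Y" "Y \<subseteq> ground M" "N = restriction (contraction M Y) X"
        unfolding minors_def by blast
      then show "N \<in> (\<lambda>(X, Y). restriction (contraction M Y) X) ` (Pow (ground M) \<times> Pow (ground M))"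
        by (intro image_eqI[of _ _ "(X, Y)"]) auto
    qed
  qed (use finite_ground in auto)
  moreover have "minors M \<noteq> {}" unfolding minors_def by blast
  ultimately have "f_width f M \<le> q \<longleftrightarrow> (\<forall>N \<in> minors M. ?g N \<le> q)" by simp
  moreover have "?g N \<le> q \<longleftrightarrow> of_nat (arc_complexity N) \<le> q * of_nat (f (card (ground N)))"
    for N :: "'a indep_system"
    using f by (simp add: pos_divide_le_eq)
  ultimately show ?thesis by simp
qed

lemma in_width_class_iff:
  assumes "super_additive f"
  shows "M \<in> width_class f q \<longleftrightarrow> gammoid M \<and>
    (\<forall>N \<in> minors M. of_nat (arc_complexity N) \<le> q * of_nat (f (card (ground N))))"
  using assms f_width_le_iff[of M f q] unfolding width_class_def super_additive_def by auto

theorem theorem3p5: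
  fixes f :: "nat \<Rightarrow> nat" and q :: rat
  assumes "super_additive f" and "q > 0"
  defines "W \<equiv> (width_class f q :: 'a::infinite indep_system set)"
  shows "(\<forall>M \<in> W. dual_matroid M \<in> W) \<and>
         (\<forall>M \<in> W. \<forall>N \<in> minors M. N \<in> W) \<and>
         (\<forall>M \<in> W. \<forall>N \<in> W. ground M \<inter> ground N = {} \<longrightarrow> direct_sum M N \<in> W)"
proof (intro conjI ballI impI)
  have W: "M \<in> W \<longleftrightarrow> gammoid M \<and>
    (\<forall>N \<in> minors M. of_nat (arc_complexity N) \<le> q * of_nat (f (card (ground N))))" for M
    unfolding W_def using assms(1) by (rule in_width_class_iff)
  fix M assume "M \<in> W"
  then have M: "gammoid M"
    and bound: "\<And>N. N \<in> minors M \<Longrightarrow> of_nat (arc_complexity N) \<le> q * of_nat (f (card (ground N)))"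
    unfolding W by blast+
  interpret M: matroid M using M by (rule gammoid_matroid)
  show "dual_matroid M \<in> W"
    unfolding W
  proof (intro conjI ballI)
    show "gammoid (dual_matroid M)" using M by (rule gammoid_dual)
    fix N assume N: "N \<in> minors (dual_matroid M)"
    then have minor: "dual_matroid N \<in> minors M" by (rule M.dual_minor_of_dual)
    have "matroid N" using M.matroid_dual N by (rule matroid.matroid_minor)
    \<comment> \<open>The bound for duals is applied to \<open>dual_matroid N\<close>, a minor of
      \<open>M\<close> and hence a gammoid, whose dual is \<open>N\<close>.\<close>
    then have "arc_complexity N \<le> arc_complexity (dual_matroid N)"
      using gammoid_dual(2)[OF gammoid_minor[OF M minor]] by (simp add: matroid.dual_dual)
    then have "(of_nat (arc_complexity N) :: rat) \<le> of_nat (arc_complexity (dual_matroid N))" by simp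
    also have "\<dots> \<le> q * of_nat (f (card (ground N)))" using bound[OF minor] by simp
    finally show "of_nat (arc_complexity N) \<le> q * of_nat (f (card (ground N)))" .
  qed
  show "N \<in> W" if "N \<in> minors M" for N
    unfolding W using gammoid_minor[OF M that] M.minors_minors[OF that] bound by blast
  fix N assume "N \<in> W" and disj: "ground M \<inter> ground N = {}"
  then have N: "gammoid N"
    and bound': "\<And>L. L \<in> minors N \<Longrightarrow> of_nat (arc_complexity L) \<le> q * of_nat (f (card (ground L)))"
    unfolding W by blast+
  interpret disjoint_matroids M N
    using disj gammoid_matroid[OF M] gammoid_matroid[OF N]
    by (simp add: disjoint_matroids_def disjoint_matroids_axioms_def)
  show "direct_sum M N \<in> W"
    unfolding W
  proof (intro conjI ballI)
    show "gammoid (direct_sum M N)" using M N disj by (rule gammoid_direct_sum)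
    fix L assume "L \<in> minors (direct_sum M N)"
    then obtain L1 L2 where L: "L1 \<in> minors M" "L2 \<in> minors N" "L = direct_sum L1 L2"
      and disj': "ground L1 \<inter> ground L2 = {}"
      by (rule minor_direct_sum)
    note gam = gammoid_minor[OF M L(1)] gammoid_minor[OF N L(2)]
    let ?n1 = "card (ground L1)" and ?n2 = "card (ground L2)"
    have fin: "finite (ground L1)" "finite (ground L2)"
      using gam gammoid_matroid matroid.finite_ground by blast+
    have card: "card (ground L) = ?n1 + ?n2"
      using card_Un_disjoint[OF fin disj'] L(3) by simp
    have le: "arc_complexity L \<le> arc_complexity L1 + arc_complexity L2"
      unfolding L(3) using gam disj' by (rule gammoid_direct_sum)
    show "of_nat (arc_complexity L) \<le> q * of_nat (f (card (ground L)))"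
    proof (cases "?n1 = 0 \<or> ?n2 = 0")
      case True
      then show ?thesis
      proof
        assume "?n1 = 0"
        then have "arc_complexity L1 = 0" using fin arc_complexity_empty[OF gam(1)] by simp
        then have "(of_nat (arc_complexity L) :: rat) \<le> of_nat (arc_complexity L2)" using le by simp
        then show ?thesis using bound'[OF L(2)] card \<open>?n1 = 0\<close> by simp
      next
        assume "?n2 = 0"
        then have "arc_complexity L2 = 0" using fin arc_complexity_empty[OF gam(2)] by simp
        then have "(of_nat (arc_complexity L) :: rat) \<le> of_nat (arc_complexity L1)" using le by simp
        then show ?thesis using bound[OF L(1)] card \<open>?n2 = 0\<close> by simp
      qed
    next
      case False
      then have "f ?n1 + f ?n2 \<le> f (card (ground L))"
        using assms(1) card by (simp add: super_additive_def)
      then have f: "(of_nat (f ?n1) + of_nat (f ?n2) :: rat) \<le> of_nat (f (card (ground L)))"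
        by (metis of_nat_add of_nat_mono)
      have "(of_nat (arc_complexity L) :: rat) \<le> of_nat (arc_complexity L1) + of_nat (arc_complexity L2)"
        using le by (metis of_nat_add of_nat_mono)
      also have "\<dots> \<le> q * (of_nat (f ?n1) + of_nat (f ?n2))"
        using bound[OF L(1)] bound'[OF L(2)] by (simp add: distrib_left)
      also have "\<dots> \<le> q * of_nat (f (card (ground L)))"
        using f assms(2) by (intro mult_left_mono) auto
      finally show ?thesis .
    qed
  qed
qed

end
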